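(* A function $f:\Omega_D\to\mathbb{O}$ is an $O(3)$-slice function (i.e. the $O(3)$-slice function induced by some $O(3)$-stem function $E\to\mathbb{O}^4$) if and only if it is a slice function. More precisely, let $\Phi$ be the map sending each $O(3)$-stem function $\mathcal F=(\mathcal F_0,\mathcal F_1,\mathcal F_2,\mathcal F_3):E\to\mathbb{O}^4$ to the function $(F_1,F_2):D\to\mathbb{O}^2$ defined by $F_1(x_0,x_1):=\mathcal F_0(x_0,x_1,0,0)$ and $F_2(x_0,x_1):=\mathcal F_1(x_0,x_1,0,0)$. Then: (1) $\Phi$ takes values in the set of stem functions on $D$, it is a bijection from the set of $O(3)$-stem functions on $E$ onto the set of stem functions on $D$, and for every $O(3)$-stem function $\mathcal F$ the $O(3)$-slice function induced by $\mathcal F$ coincides with the slice function induced by $\Phi(\mathcal F)$. (2) If $F=(F_1,F_2):D\to\mathbb{O}^2$ is a stem function and $\mathcal F=(\mathcal F_0,\dots,\mathcal F_3)=\Phi^{-1}(F)$, then for every $v=(x_0,x_1,x_2,x_3)\in E$ with $r:=(x_1^2+x_2^2+x_3^2)^{1/2}>0$ one has $\mathcal F_0(v)=F_1(x_0,r)$ and $\mathcal F_h(v)=\frac{x_h}{r}F_2(x_0,r)$ for $h\in\{1,2,3\}$. In particular, $F$ is real analytic if and only if $\Phi^{-1}(F)$ is real analytic.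
   Context: Octonions: $\mathbb{O}=\mathbb{H}+\ell\mathbb{H}$ with product $(a+\ell b)(c+\ell d)=(ac-d\bar b)+\ell(\bar a d+cb)$ and conjugation $\overline{a+\ell b}=\bar a-\ell b$ ($a,b,c,d\in\mathbb{H}$); $\mathbb{O}$ is identified with $\mathbb{R}^8$ through the real basis $(1,i,j,k,\ell,\ell i,\ell j,\ell k)$, with Euclidean topology and norm $|x|$. $\mathbb{S}=\{I\in\mathbb{O}:I^2=-1\}$. Let $D\subset\mathbb{R}^2$ be a non-empty open set invariant under $(\alpha,\beta)\mapsto(\alpha,-\beta)$ and $\Omega_D=\{\alpha+\beta I:(\alpha,\beta)\in D, I\in\mathbb{S}\}$; assume $\Omega_D$ is connected. A stem function on $D$ is $F=(F_1,F_2):D\to\mathbb{O}^2$ with $F_1(\alpha,-\beta)=F_1(\alpha,\beta)$ and $F_2(\alpha,-\beta)=-F_2(\alpha,\beta)$. A function $f:\Omega_D\to\mathbb{O}$ is a slice function if there is a stem function $F$ with $f(\alpha+\beta I)=F_1(\alpha,\beta)+IF_2(\alpha,\beta)$ for all $(\alpha,\beta)\in D$, $I\in\mathbb{S}$ ($F$ is unique and is said to induce $f$). Identify $\mathbb{R}^2$ with $\mathbb{R}^2\times\{(0,0)\}\subset\mathbb{R}^4$ and let $E=\{(x_0,x_1,x_2,x_3)\in\mathbb{R}^4:(x_0,(x_1^2+x_2^2+x_3^2)^{1/2})\in D\}$, so $E\cap\mathbb{R}^2=D$. $O(3)$ is identified with the group of real orthogonal $4\times4$ matrices fixing the first canonical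 basis vector; such a matrix $A$ acts on $\mathbb{R}^4$ and on $\mathbb{O}^4$ by matrix–column multiplication, and $E$ is $O(3)$-invariant. $\mathcal N=\{(I,J)\in\mathbb{S}\times\mathbb{S}:I\perp J\}$ (orthogonality in $\mathbb{R}^8$). An $O(3)$-stem function is $\mathcal F:E\to\mathbb{O}^4$ with $\mathcal F(Av)=A\mathcal F(v)$ for all $v\in E$, $A\in O(3)$. One has $\Omega_D=\{x_0+x_1I+x_2J+x_3(IJ):(x_0,\dots,x_3)\in E,(I,J)\in\mathcal N\}$, and for an $O(3)$-stem function $\mathcal F$ the rule $f(x_0+x_1I+x_2J+x_3(IJ))=\mathcal F_0(v)+I\mathcal F_1(v)+J\mathcal F_2(v)+(IJ)\mathcal F_3(v)$ ($v=(x_0,\dots,x_3)\in E$, $(I,J)\in\mathcal N$) gives a well-defined function $f:\Omega_D\to\mathbb{O}$, the $O(3)$-slice function induced by $\mathcal F$. *)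

theory Defs
  imports "HOL-Analysis.Analysis" "HOL-Library.FuncSet"
begin

text \<open>Quaternions: real^4 with coordinates (1,i,j,k) at indices 0,1,2,3.
  Octonions: real^8 with coordinates (1,i,j,k,l,li,lj,lk) at indices 0..7,
  so the Euclidean structure of real^8 is the one of the paper.
  Beware: the vector type has its own componentwise product and unit;
  the octonion product is omul and the octonion unit is oone.\<close>

type_synonym quat = "real^4"
type_synonym oct = "real^8"

definition qmul :: "quat \<Rightarrow> quat \<Rightarrow> quat" where
  "qmul p q = (\<chi> i.
     if i = 0 then p$0*q$0 - p$1*q$1 - p$2*q$2 - p$3*q$3
     else if i = 1 then p$0*q$1 + p$1*q$0 + p$2*q$3 - p$3*q$2
     else if i = 2 then p$0*q$2 - p$1*q$3 + p$2*q$0 + p$3*q$1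
     else p$0*q$3 + p$1*q$2 - p$2*q$1 + p$3*q$0)"

definition qconj :: "quat \<Rightarrow> quat" where
  "qconj p = (\<chi> i. if i = 0 then p$0 else - p$i)"

text \<open>x = a + l b with a, b quaternions.\<close>
definition oct_a :: "oct \<Rightarrow> quat" where
  "oct_a x = (\<chi> i. if i = 0 then x$0 else if i = 1 then x$1 else if i = 2 then x$2 else x$3)"

definition oct_b :: "oct \<Rightarrow> quat" where
  "oct_b x = (\<chi> i. if i = 0 then x$4 else if i = 1 then x$5 else if i = 2 then x$6 else x$7)"

definition mk_oct :: "quat \<Rightarrow> quat \<Rightarrow> oct" where
  "mk_oct a b = (\<chi> i. if i = 0 then a$0 else if i = 1 then a$1 else if i = 2 then a$2
      else if i = 3 then a$3 else if i = 4 then b$0 else if i = 5 then b$1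
      else if i = 6 then b$2 else b$3)"

text \<open>(a + l b)(c + l d) = (ac - d conj(b)) + l(conj(a) d + c b).\<close>
definition omul :: "oct \<Rightarrow> oct \<Rightarrow> oct" where
  "omul x y = mk_oct (qmul (oct_a x) (oct_a y) - qmul (oct_b y) (qconj (oct_b x)))
                     (qmul (qconj (oct_a x)) (oct_b y) + qmul (oct_a y) (oct_b x))"

definition oconj :: "oct \<Rightarrow> oct" where
  "oconj x = mk_oct (qconj (oct_a x)) (- oct_b x)"

definition oone :: oct where
  "oone = axis 0 1"

definition Ssph :: "oct set" where
  "Ssph = {I. omul I I = - oone}"

definition Npairs :: "(oct \<times> oct) set" where
  "Npairs = {(I, J). I \<in> Ssph \<and> J \<in> Ssph \<and> I \<bullet> J = 0}"

definition OmegaD :: "(real \<times> real) set \<Rightarrow> oct set" where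
  "OmegaD D = {a *\<^sub>R oone + b *\<^sub>R I | a b I. (a, b) \<in> D \<and> I \<in> Ssph}"

definition Edom :: "(real \<times> real) set \<Rightarrow> (real^4) set" where
  "Edom D = {x. (x$0, sqrt ((x$1)\<^sup>2 + (x$2)\<^sup>2 + (x$3)\<^sup>2)) \<in> D}"

definition emb2 :: "real \<Rightarrow> real \<Rightarrow> real^4" where
  "emb2 a b = (\<chi> i. if i = 0 then a else if i = 1 then b else 0)"

definition O3 :: "(real^4^4) set" where
  "O3 = {A. orthogonal_matrix A \<and> A *v axis 0 1 = axis 0 1}"

definition act :: "real^4^4 \<Rightarrow> oct^4 \<Rightarrow> oct^4" where
  "act A w = (\<chi> i. \<Sum>j\<in>UNIV. A$i$j *\<^sub>R w$j)"

definition stems :: "(real \<times> real) set \<Rightarrow> (real \<times> real \<Rightarrow> oct \<times> oct) set" where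
  "stems D = {F \<in> extensional D. \<forall>(a, b) \<in> D.
      fst (F (a, -b)) = fst (F (a, b)) \<and> snd (F (a, -b)) = - snd (F (a, b))}"

text \<open>f is the slice function induced by F (only values on Omega_D matter).\<close>
definition slice_induced :: "(real \<times> real) set \<Rightarrow> (real \<times> real \<Rightarrow> oct \<times> oct) \<Rightarrow> (oct \<Rightarrow> oct) \<Rightarrow> bool" where
  "slice_induced D F f \<longleftrightarrow> (\<forall>(a, b) \<in> D. \<forall>I \<in> Ssph.
      f (a *\<^sub>R oone + b *\<^sub>R I) = fst (F (a, b)) + omul I (snd (F (a, b))))"

definition is_slice :: "(real \<times> real) set \<Rightarrow> (oct \<Rightarrow> oct) \<Rightarrow> bool" where
  "is_slice D f \<longleftrightarrow> (\<exists>F \<in> stems D. slice_induced D F f)"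

definition O3stems :: "(real^4) set \<Rightarrow> (real^4 \<Rightarrow> oct^4) set" where
  "O3stems E = {G \<in> extensional E. \<forall>v \<in> E. \<forall>A \<in> O3. G (A *v v) = act A (G v)}"

definition O3_induced :: "(real^4) set \<Rightarrow> (real^4 \<Rightarrow> oct^4) \<Rightarrow> (oct \<Rightarrow> oct) \<Rightarrow> bool" where
  "O3_induced E G f \<longleftrightarrow> (\<forall>v \<in> E. \<forall>(I, J) \<in> Npairs.
      f (v$0 *\<^sub>R oone + v$1 *\<^sub>R I + v$2 *\<^sub>R J + v$3 *\<^sub>R omul I J)
        = G v $ 0 + omul I (G v $ 1) + omul J (G v $ 2) + omul (omul I J) (G v $ 3))"

definition is_O3_slice :: "(real \<times> real) set \<Rightarrow> (oct \<Rightarrow> oct) \<Rightarrow> bool" where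
  "is_O3_slice D f \<longleftrightarrow> (\<exists>G \<in> O3stems (Edom D). O3_induced (Edom D) G f)"

definition Phi :: "(real \<times> real) set \<Rightarrow> (real^4 \<Rightarrow> oct^4) \<Rightarrow> (real \<times> real \<Rightarrow> oct \<times> oct)" where
  "Phi D G = restrict (\<lambda>(a, b). (G (emb2 a b) $ 0, G (emb2 a b) $ 1)) D"

text \<open>A real-valued function is real analytic on S if near every point of S it is
  the sum of an (absolutely = unconditionally) convergent power series in the
  coordinates; a vector-valued function is real analytic if all its real
  coordinates are.\<close>
definition real_analytic_on :: "('a::euclidean_space \<Rightarrow> 'b::euclidean_space) \<Rightarrow> 'a set \<Rightarrow> bool" where
  "real_analytic_on f S \<longleftrightarrow> (\<forall>e \<in> Basis. \<forall>p \<in> S. \<exists>r > 0. \<exists>c :: ('a \<Rightarrow> nat) \<Rightarrow> real.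
      \<forall>x \<in> ball p r.
        ((\<lambda>\<alpha>. c \<alpha> * (\<Prod>i\<in>Basis. ((x - p) \<bullet> i) ^ \<alpha> i)) has_sum (f x \<bullet> e))
          {\<alpha>. \<forall>i. i \<notin> Basis \<longrightarrow> \<alpha> i = 0})"

end

theory Submission
  imports Defs
begin

text \<open>
  Every v in E is the image of \<open>(x0, r, 0, 0)\<close> under some reflection in \<open>O3\<close>, where r is the norm of
  \<open>(x1, x2, x3)\<close>, and the coordinate reflections force the components 2 and 3 of an \<open>O3\<close>-stem function
  to vanish at \<open>(x0, r, 0, 0)\<close>. Equivariance then gives the explicit formula of part (2), hence the
  bijection. For \<open>r > 0\<close> and \<open>(I, J) \<in> Npairs\<close>, the combination of I, J and IJ with coefficients
  \<open>xh / r\<close> is again in \<open>Ssph\<close>, which identifies the induced functions.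

  Analyticity passes from the \<open>O3\<close>-stem function to F by restriction to a plane. In the other direction r is analytic
  where it is positive, by the binomial series. At \<open>r = 0\<close>, parity in the second variable makes \<open>F1\<close> a
  power series in \<open>(x0, r^2)\<close> and \<open>F2\<close> equal to r times such a series.
\<close>

subsection \<open>Octonion arithmetic\<close>

lemma UNIV_8: "(UNIV :: 8 set) = {0, 1, 2, 3, 4, 5, 6, 7}"
proof -
  have "card {0, 1, 2, 3, 4, 5, 6, 7 :: 8} = CARD(8)" by simp
  then show ?thesis by (metis card_subset_eq finite subset_UNIV)
qed

text \<open>Index 0 is the real coordinate, so the residues are listed from 0; the numeral 4 names
  this same index.\<close>

lemma UNIV_4_from_0: "(UNIV :: 4 set) = {0, 1, 2, 3}"
proof -
  have "card {0, 1, 2, 3 :: 4} = CARD(4)" by simp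
  then show ?thesis by (metis card_subset_eq finite subset_UNIV)
qed

lemma sum_8: "sum f (UNIV :: 8 set) = f 0 + f 1 + f 2 + f 3 + f 4 + f 5 + f 6 + f 7"
  unfolding UNIV_8 by (simp add: ac_simps)

lemma sum_4_from_0: "sum f (UNIV :: 4 set) = f 0 + f 1 + f 2 + f 3"
  unfolding UNIV_4_from_0 by (simp add: ac_simps)

lemma forall_8: "(\<forall>i::8. P i) \<longleftrightarrow> P 0 \<and> P 1 \<and> P 2 \<and> P 3 \<and> P 4 \<and> P 5 \<and> P 6 \<and> P 7"
  using UNIV_8 by (metis UNIV_I insert_iff empty_iff)

lemma forall_4_from_0: "(\<forall>i::4. P i) \<longleftrightarrow> P 0 \<and> P 1 \<and> P 2 \<and> P 3"
  using UNIV_4_from_0 by (metis UNIV_I insert_iff empty_iff)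

lemma inner_oct: "(x::oct) \<bullet> y = x$0*y$0 + x$1*y$1 + x$2*y$2 + x$3*y$3 + x$4*y$4 + x$5*y$5 + x$6*y$6 + x$7*y$7"
  by (simp add: inner_vec_def sum_8)

lemmas omul_simps = omul_def mk_oct_def oct_a_def oct_b_def qmul_def qconj_def

lemma omul_add_left: "omul (x + y) z = omul x z + omul y z"
  by (simp add: vec_eq_iff forall_8 omul_simps algebra_simps)

lemma omul_scaleR_left: "omul (a *\<^sub>R x) z = a *\<^sub>R omul x z"
  by (simp add: vec_eq_iff forall_8 omul_simps algebra_simps)

lemma omul_scaleR_right: "omul x (a *\<^sub>R z) = a *\<^sub>R omul x z"
  by (simp add: vec_eq_iff forall_8 omul_simps algebra_simps)

lemma omul_zero_right: "omul x 0 = 0"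
  using omul_scaleR_right[of x 0 0] by simp

text \<open>Left multiplication by x multiplies all inner products by \<open>x \<bullet> x\<close>.
  Since x is x times 1, only the real part of y is left.\<close>

lemma omul_inner_left: "omul x y \<bullet> x = y $ 0 * (x \<bullet> x)"
  by (simp add: inner_oct omul_simps algebra_simps)

lemma omul_inner_right: "omul x y \<bullet> y = x $ 0 * (y \<bullet> y)"
  by (simp add: inner_oct omul_simps algebra_simps)

text \<open>The eight-square identity: the octonions are a composition algebra.\<close>

lemma omul_inner_omul: "omul x y \<bullet> omul x y = (x \<bullet> x) * (y \<bullet> y)"
  by (simp add: inner_oct omul_simps algebra_simps)

text \<open>The inner product is the real part of x times the conjugate of y, and y is
  \<open>2 * y $ 0\<close> minus its conjugate.\<close>

lemma omul_nth_0: "omul x y $ 0 = 2 * x $ 0 * y $ 0 - x \<bullet> y"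
  by (simp add: inner_oct omul_simps algebra_simps)

lemma oone_nth: "oone $ i = (if i = 0 then 1 else 0)"
  by (simp add: oone_def axis_def)

text \<open>Every octonion is a root of a real quadratic polynomial with trace
  \<open>2 * x $ 0\<close> and norm \<open>x \<bullet> x\<close>. This turns the equation defining
  \<open>Ssph\<close> into a linear relation between I and \<open>oone\<close>.\<close>

lemma omul_self: "omul x x = (2 * x $ 0) *\<^sub>R x - (x \<bullet> x) *\<^sub>R oone"
  by (simp add: vec_eq_iff forall_8 inner_oct omul_simps oone_nth algebra_simps)

text \<open>So \<open>Ssph\<close> is the unit sphere of the imaginary octonions. If I had nonzero
  real part, the quadratic equation would make I real, and a real square is not -1.\<close>

lemma Ssph_iff: "I \<in> Ssph \<longleftrightarrow> I $ 0 = 0 \<and> I \<bullet> I = 1"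
proof
  assume "I \<in> Ssph"
  then have eq: "(2 * I $ 0) *\<^sub>R I - (I \<bullet> I) *\<^sub>R oone = - oone"
    by (simp add: Ssph_def omul_self)
  have *: "2 * I $ 0 * I $ i - (I \<bullet> I) * oone $ i = - (oone $ i)" for i
    using arg_cong[OF eq, of "\<lambda>x. x $ i"] by simp
  have "I $ 0 = 0"
  proof (rule ccontr)
    assume "I $ 0 \<noteq> 0"
    then have "I $ i = 0" if "i \<noteq> 0" for i using *[of i] that by (simp add: oone_nth)
    then have "I \<bullet> I = I $ 0 * I $ 0" by (simp add: inner_oct)
    then have "I $ 0 * I $ 0 = -1" using *[of 0] by (simp add: oone_nth)
    then show False using zero_le_square[of "I $ 0"] by linarith
  qed
  then show "I $ 0 = 0 \<and> I \<bullet> I = 1" using *[of 0] by (simp add: oone_nth)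
qed (simp add: Ssph_def omul_self)

lemma Npairs_exists:
  assumes "I \<in> Ssph"
  obtains J where "(I, J) \<in> Npairs"
proof -
  \<comment> \<open>If I has no component along i and j, the unit i is orthogonal to it. Otherwise
    the pair of these two components is turned by a right angle.\<close>
  define v :: oct where "v = (if I $ 1 = 0 \<and> I $ 2 = 0 then axis 1 1 else \<chi> i. if i = 1 then I $ 2 else if i = 2 then - (I $ 1) else 0)"
  have v: "v $ 0 = 0" "I \<bullet> v = 0" by (auto simp: v_def inner_oct axis_def)
  have "v \<noteq> 0" by (auto simp: v_def vec_eq_iff forall_8 axis_def)
  then have "(1 / norm v) *\<^sub>R v \<in> Ssph"
    using v by (simp add: Ssph_iff power2_norm_eq_inner[symmetric] power2_eq_square)
  then have "(I, (1 / norm v) *\<^sub>R v) \<in> Npairs" using assms v by (simp add: Npairs_def)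
  then show thesis by (rule that)
qed

text \<open>I, J and IJ are imaginary and orthonormal: the real part of IJ is minus the inner
  product of I and J, IJ is orthogonal to both factors because these are imaginary, and norms
  multiply.\<close>

lemma Npairs_combination_in_Ssph:
  assumes "(I, J) \<in> Npairs" "a\<^sup>2 + b\<^sup>2 + c\<^sup>2 = 1"
  shows "a *\<^sub>R I + b *\<^sub>R J + c *\<^sub>R omul I J \<in> Ssph"
proof -
  have IJ: "I $ 0 = 0" "I \<bullet> I = 1" "J $ 0 = 0" "J \<bullet> J = 1" "I \<bullet> J = 0" "J \<bullet> I = 0"
    using assms(1) by (auto simp: Npairs_def Ssph_iff inner_commute)
  have "omul I J $ 0 = 0" "omul I J \<bullet> omul I J = 1" "omul I J \<bullet> I = 0" "omul I J \<bullet> J = 0"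
    "I \<bullet> omul I J = 0" "J \<bullet> omul I J = 0"
    using IJ by (simp_all add: omul_nth_0 omul_inner_omul omul_inner_left omul_inner_right
        inner_commute[of I "omul I J"] inner_commute[of J "omul I J"])
  with IJ assms(2) show ?thesis
    by (simp add: Ssph_iff inner_add_left inner_add_right power2_eq_square)
qed

section \<open>Coordinates and radius in R^4\<close>

lemma emb2_nth [simp]: "emb2 a b $ 0 = a" "emb2 a b $ 1 = b" "emb2 a b $ 2 = 0" "emb2 a b $ 3 = 0"
  by (simp_all add: emb2_def)

text \<open>Together with \<open>v $ 0\<close> this number labels the orbits of
  \<open>O3\<close>.\<close>

definition imnorm :: "real^4 \<Rightarrow> real" where
  "imnorm v = sqrt ((v$1)\<^sup>2 + (v$2)\<^sup>2 + (v$3)\<^sup>2)"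

lemma inner_quat: "(x::real^4) \<bullet> y = x$0*y$0 + x$1*y$1 + x$2*y$2 + x$3*y$3"
  by (simp add: inner_vec_def sum_4_from_0)

lemma imnorm_eq_0: "imnorm v = 0 \<longleftrightarrow> v$1 = 0 \<and> v$2 = 0 \<and> v$3 = 0"
proof
  assume "imnorm v = 0"
  then have "(v$1)\<^sup>2 + (v$2)\<^sup>2 + (v$3)\<^sup>2 = 0" by (simp add: imnorm_def)
  then show "v$1 = 0 \<and> v$2 = 0 \<and> v$3 = 0"
    by (smt (verit) zero_le_power2 zero_eq_power2)
qed (simp add: imnorm_def)

lemma imnorm_power2: "(imnorm v)\<^sup>2 = (v$1)\<^sup>2 + (v$2)\<^sup>2 + (v$3)\<^sup>2"
  by (simp add: imnorm_def)

lemma imnorm_emb2: "imnorm (emb2 a b) = \<bar>b\<bar>"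
  by (simp add: imnorm_def)

lemma Edom_iff: "v \<in> Edom D \<longleftrightarrow> (v$0, imnorm v) \<in> D"
  by (simp add: Edom_def imnorm_def)

subsection \<open>Reflections and equivariance\<close>

text \<open>The reflection in the hyperplane orthogonal to u. For u = 0, division by zero makes it
  the identity.\<close>

definition reflect :: "real^4 \<Rightarrow> real^4 \<Rightarrow> real^4" where
  "reflect u x = x - (2 * (u \<bullet> x) / (u \<bullet> u)) *\<^sub>R u"

text \<open>The axis of index 0 is orthogonal to u, so the reflection fixes it.\<close>

lemma reflect_in_O3:
  assumes "u $ 0 = 0"
  shows "matrix (reflect u) \<in> O3" and "matrix (reflect u) *v x = reflect u x"
proof -
  have lin: "linear (reflect u)"
    by (rule linearI)
      (simp_all add: reflect_def inner_add_right algebra_simps add_divide_distrib)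
  then show eq: "matrix (reflect u) *v x = reflect u x" for x
    using fun_cong[OF matrix_vector_mul(2)] by blast
  have "reflect u x \<bullet> reflect u y = x \<bullet> y" for x y
    by (cases "u = 0")
      (simp_all add: reflect_def inner_diff_left inner_diff_right inner_commute field_simps)
  with lin have "orthogonal_transformation (reflect u)"
    by (simp add: orthogonal_transformation_def)
  then have "orthogonal_matrix (matrix (reflect u))"
    by (simp add: orthogonal_transformation_matrix)
  moreover have "reflect u (axis 0 1) = axis 0 1"
    using assms by (simp add: reflect_def inner_axis)
  ultimately show "matrix (reflect u) \<in> O3" by (simp add: O3_def eq)
qed

text \<open>The first column is prescribed by \<open>O3\<close>. For the first row, the transpose is
  the inverse and therefore fixes the same axis.\<close>

lemma O3_nth:
  assumes "A \<in> O3"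
  shows "A $ i $ 0 = (if i = 0 then 1 else 0)" "A $ 0 $ i = (if i = 0 then 1 else 0)"
proof -
  have A: "orthogonal_matrix A" "A *v axis 0 1 = axis 0 1" using assms by (auto simp: O3_def)
  have "(B *v axis 0 1) $ i = B $ i $ 0" for B :: "real^4^4" and i
    by (simp add: matrix_vector_mult_def axis_def if_distrib cong: if_cong)
  note col = this
  show "A $ i $ 0 = (if i = 0 then 1 else 0)"
    using col[of A i] A(2) by (simp add: axis_def)
  have "transpose A *v axis 0 1 = transpose A *v (A *v axis 0 1)" using A(2) by simp
  also have "\<dots> = axis 0 1"
    using A(1) by (simp add: matrix_vector_mul_assoc orthogonal_matrix_def)
  finally have "transpose A *v axis 0 1 = axis 0 1" .
  then show "A $ 0 $ i = (if i = 0 then 1 else 0)"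
    using col[of "transpose A" i] by (simp add: axis_def transpose_def)
qed

lemma O3_vec_nth:
  assumes "A \<in> O3"
  shows "(A *v v) $ 0 = v $ 0" "imnorm (A *v v) = imnorm v"
    and "i \<noteq> 0 \<Longrightarrow> (A *v v) $ i = A$i$1 * v$1 + A$i$2 * v$2 + A$i$3 * v$3"
proof -
  show 0: "(A *v v) $ 0 = v $ 0"
    by (simp add: matrix_vector_mult_def sum_4_from_0 O3_nth[OF assms])
  show "(A *v v) $ i = A$i$1 * v$1 + A$i$2 * v$2 + A$i$3 * v$3" if "i \<noteq> 0"
    using that by (simp add: matrix_vector_mult_def sum_4_from_0 O3_nth[OF assms])
  have "(A *v v) \<bullet> (A *v v) = v \<bullet> v"
    using assms orthogonal_transformation_matrix[of "(*v) A"]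
    by (simp add: O3_def orthogonal_transformation_def)
  then show "imnorm (A *v v) = imnorm v"
    using 0 by (simp add: inner_quat imnorm_def power2_eq_square)
qed

text \<open>The reflection along the difference of two vectors of equal norm exchanges them. Here
  both vectors agree in coordinate 0, so this reflection lies in \<open>O3\<close>.\<close>

lemma O3_maps_emb2:
  obtains A where "A \<in> O3" "A *v emb2 (v$0) (imnorm v) = v"
proof -
  let ?w = "emb2 (v$0) (imnorm v)"
  define u where "u = ?w - v"
  have u0: "u $ 0 = 0" by (simp add: u_def)
  have eq: "?w \<bullet> ?w = v \<bullet> v" by (simp add: inner_quat imnorm_power2 power2_eq_square[symmetric])
  have "reflect u ?w = v"
  proof (cases "u = 0")
    case False
    have "2 * (u \<bullet> ?w) = u \<bullet> u"
      using eq by (simp add: u_def inner_diff_left inner_diff_right inner_commute)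
    with False have "reflect u ?w = ?w - u" by (simp add: reflect_def)
    then show ?thesis by (simp add: u_def)
  qed (simp add: reflect_def u_def)
  then show thesis using that reflect_in_O3[OF u0] by metis
qed

lemma act_nth: "act A w $ i = A$i$0 *\<^sub>R w$0 + A$i$1 *\<^sub>R w$1 + A$i$2 *\<^sub>R w$2 + A$i$3 *\<^sub>R w$3"
  by (simp add: act_def sum_4_from_0)

text \<open>The sign change of one coordinate serves twice: as a symmetry fixing the vectors with
  \<open>v $ k = 0\<close>, and, for k = 1, as the map from \<open>emb2 a b\<close> to
  \<open>emb2 a (- b)\<close>.\<close>

lemma reflect_axis:
  assumes "k \<noteq> 0"
  obtains A where "A \<in> O3" "\<And>v. v $ k = 0 \<Longrightarrow> A *v v = v" "\<And>w. act A w $ k = - w $ k"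
    "\<And>v j. (A *v v) $ j = (if j = k then - v $ j else v $ j)"
proof
  let ?A = "matrix (reflect (axis k 1))"
  have 0: "axis k 1 $ 0 = (0::real)" using assms by (simp add: axis_def)
  show "?A \<in> O3" by (rule reflect_in_O3[OF 0])
  have eq: "?A *v x = reflect (axis k 1) x" for x by (rule reflect_in_O3[OF 0])
  show "?A *v v = v" if "v $ k = 0" for v
    using that by (simp add: eq reflect_def inner_axis inner_commute)
  show *: "(?A *v v) $ j = (if j = k then - v $ j else v $ j)" for v j
    by (simp add: eq reflect_def inner_axis inner_commute[of "axis k 1"], simp add: axis_def)
  have "?A $ i $ j = (if i = j then if i = k then -1 else 1 else 0)" for i j
  proof -
    have "?A $ i $ j = (?A *v axis j 1) $ i"
      by (simp add: matrix_vector_mult_def axis_def if_distrib cong: if_cong)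
    also have "\<dots> = (if i = j then if i = k then -1 else 1 else 0)"
      unfolding * by (simp add: axis_def)
    finally show ?thesis .
  qed
  then show "act ?A w $ k = - w $ k" for w
    by (simp add: act_def if_distrib[of "\<lambda>a. a *\<^sub>R _"] cong: if_cong)
qed

section \<open>Correspondence between the two kinds of stem functions\<close>

context
  fixes D :: "(real \<times> real) set"
  assumes sym: "\<forall>(a, b) \<in> D. (a, - b) \<in> D"
begin

lemma sym_D: "(a, b) \<in> D \<Longrightarrow> (a, - b) \<in> D"
  using sym by auto

lemma emb2_in_Edom: "(a, b) \<in> D \<Longrightarrow> emb2 a b \<in> Edom D"
  using sym_D[of a b] by (auto simp: Edom_iff imnorm_emb2 abs_if)

lemma Edom_imnorm: "v \<in> Edom D \<Longrightarrow> (v$0, imnorm v) \<in> D"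
  by (simp add: Edom_iff)

lemma O3_Edom: "v \<in> Edom D \<Longrightarrow> A \<in> O3 \<Longrightarrow> A *v v \<in> Edom D"
  by (simp add: Edom_iff O3_vec_nth)

text \<open>The sign change of coordinate k fixes v but negates component k of
  \<open>G v\<close>.\<close>

lemma O3stem_fixed_coord:
  assumes G: "G \<in> O3stems (Edom D)" and v: "v \<in> Edom D" and k: "k \<noteq> 0" "v $ k = 0"
  shows "G v $ k = 0"
proof -
  obtain A where A: "A \<in> O3" "A *v v = v" "act A (G v) $ k = - G v $ k"
    using reflect_axis[OF k(1)] k(2) by metis
  have "G (A *v v) = act A (G v)" using G v A(1) by (simp add: O3stems_def)
  then have "G v $ k = - G v $ k" using A by simp
  then show ?thesis by (simp add: eq_neg_iff_add_eq_0 flip: scaleR_2)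
qed

lemma Phi_apply: "(a, b) \<in> D \<Longrightarrow> Phi D G (a, b) = (G (emb2 a b) $ 0, G (emb2 a b) $ 1)"
  by (simp add: Phi_def)

text \<open>Some A in \<open>O3\<close> carries \<open>emb2 (v$0) (imnorm v)\<close> to v.
  Components 2 and 3 of G vanish at that point, so equivariance involves only columns 0 and 1 of
  A.\<close>

lemma O3stem_formula:
  assumes G: "G \<in> O3stems (Edom D)" and v: "v \<in> Edom D"
  shows "G v $ 0 = fst (Phi D G (v$0, imnorm v))"
    and "h \<noteq> 0 \<Longrightarrow> G v $ h = (v$h / imnorm v) *\<^sub>R snd (Phi D G (v$0, imnorm v))"
proof -
  let ?w = "emb2 (v$0) (imnorm v)"
  obtain A where A: "A \<in> O3" "A *v ?w = v" by (rule O3_maps_emb2)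
  have w: "?w \<in> Edom D" using Edom_imnorm[OF v] by (rule emb2_in_Edom)
  have "G (A *v ?w) = act A (G ?w)" using G w A(1) by (simp add: O3stems_def)
  moreover have "G ?w $ 2 = 0" "G ?w $ 3 = 0"
    using O3stem_fixed_coord[OF G w] by auto
  ultimately have Gv: "G v $ i = A$i$0 *\<^sub>R G ?w $ 0 + A$i$1 *\<^sub>R G ?w $ 1" for i
    using A(2) by (simp add: act_nth)
  show "G v $ 0 = fst (Phi D G (v$0, imnorm v))"
    using Gv[of 0] Phi_apply[OF Edom_imnorm[OF v]] by (simp add: O3_nth[OF A(1)])
  show "G v $ h = (v$h / imnorm v) *\<^sub>R snd (Phi D G (v$0, imnorm v))" if h: "h \<noteq> 0"
  proof (cases "imnorm v = 0")
    case True
    \<comment> \<open>At radius 0 both sides are zero, the right one through division by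
      zero.\<close>
    then have "v $ h = 0" using h forall_4_from_0[of "\<lambda>h. h \<noteq> 0 \<longrightarrow> v $ h = 0"]
      unfolding imnorm_eq_0 by simp
    then show ?thesis using O3stem_fixed_coord[OF G v h] by simp
  next
    case False
    \<comment> \<open>Coordinate h of \<open>A *v ?w = v\<close> determines the entry of column
      1.\<close>
    have "v $ h = A$h$1 * imnorm v"
      using O3_vec_nth(3)[OF A(1) h, of ?w] A(2) by simp
    with False have "A$h$1 = v$h / imnorm v" by (simp add: field_simps)
    then show ?thesis
      using Gv[of h] h Phi_apply[OF Edom_imnorm[OF v]] by (simp add: O3_nth[OF A(1)])
  qed
qed

text \<open>Oddness of the second component comes from the sign change of coordinate 1. Evenness of
  the first is read off the formula, since b and -b give the same \<open>imnorm\<close>.\<close>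

lemma Phi_in_stems:
  assumes G: "G \<in> O3stems (Edom D)"
  shows "Phi D G \<in> stems D"
proof -
  have "fst (Phi D G (a, - b)) = fst (Phi D G (a, b)) \<and> snd (Phi D G (a, - b)) = - snd (Phi D G (a, b))"
    if ab: "(a, b) \<in> D" for a b
  proof -
    obtain A where A: "A \<in> O3" "\<And>w. act A w $ 1 = - w $ 1"
        "\<And>v j. (A *v v) $ j = (if j = 1 then - v $ j else v $ j)"
      using reflect_axis[OF one_neq_zero] by metis
    have eq: "A *v emb2 a b = emb2 a (- b)"
      by (simp add: vec_eq_iff forall_4_from_0 A(3))
    have "G (emb2 a (- b)) = act A (G (emb2 a b))"
      using G emb2_in_Edom[OF ab] A(1) eq by (fastforce simp: O3stems_def)
    then show ?thesis
      using Phi_apply[OF ab] Phi_apply[OF sym_D[OF ab]] A(2)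
        O3stem_formula(1)[OF G emb2_in_Edom[OF ab]] O3stem_formula(1)[OF G emb2_in_Edom[OF sym_D[OF ab]]]
      by (simp add: imnorm_emb2)
  qed
  moreover have "Phi D G \<in> extensional D" by (simp add: Phi_def)
  ultimately show ?thesis by (auto simp: stems_def)
qed

text \<open>Where \<open>imnorm v = 0\<close>, the convention \<open>x / 0 = 0\<close> gives the correct value 0 in the components 1, 2, 3.\<close>
definition stem_extension :: "(real \<times> real \<Rightarrow> oct \<times> oct) \<Rightarrow> real^4 \<Rightarrow> oct^4" where
  "stem_extension F = (\<lambda>v\<in>Edom D. \<chi> h. if h = 0 then fst (F (v$0, imnorm v))
     else (v$h / imnorm v) *\<^sub>R snd (F (v$0, imnorm v)))"

text \<open>\<open>O3\<close> preserves \<open>v $ 0\<close> and \<open>imnorm v\<close>, while the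
  factors \<open>v $ h / imnorm v\<close> transform linearly with v.\<close>

lemma stem_extension_in_O3stems: "stem_extension F \<in> O3stems (Edom D)"
proof -
  have "stem_extension F (A *v v) $ i = act A (stem_extension F v) $ i"
    if v: "v \<in> Edom D" and A: "A \<in> O3" for v A i
    using O3_Edom[OF v A] v
    by (simp add: stem_extension_def O3_vec_nth[OF A] act_nth O3_nth[OF A] add_divide_distrib scaleR_add_left)
  then show ?thesis by (simp add: O3stems_def vec_eq_iff stem_extension_def)
qed

text \<open>The extension evaluates F at radius |b|. For negative b, parity undoes this: F1 is even,
  and the sign b / |b| matches the oddness of F2.\<close>

lemma Phi_stem_extension:
  assumes F: "F \<in> stems D"
  shows "Phi D (stem_extension F) = F"
proof
  fix x :: "real \<times> real"
  obtain a b where x: "x = (a, b)" by (cases x)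
  have Fe: "F \<in> extensional D" and Fs: "\<And>a b. (a, b) \<in> D \<Longrightarrow>
      fst (F (a, -b)) = fst (F (a, b)) \<and> snd (F (a, -b)) = - snd (F (a, b))"
    using F by (auto simp: stems_def)
  show "Phi D (stem_extension F) x = F x"
  proof (cases "x \<in> D")
    case False
    then show ?thesis using Fe by (simp add: Phi_def extensional_def x)
  next
    case True
    then have ab: "(a, b) \<in> D" by (simp add: x)
    \<comment> \<open>At b = 0 the extension gives 0 by division by zero, and oddness forces the
      same value on F.\<close>
    have "snd (F (a, 0)) = 0" if "b = 0"
    proof -
      have "snd (F (a, 0)) = - snd (F (a, 0))" using Fs[OF ab] that by simp
      then show ?thesis by (simp add: eq_neg_iff_add_eq_0 flip: scaleR_2)
    qed
    then show ?thesis
      using emb2_in_Edom[OF ab] Phi_apply[OF ab] Fs[OF ab]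
      by (cases b "0::real" rule: linorder_cases) (auto simp: x stem_extension_def prod_eq_iff imnorm_emb2)
  qed
qed

lemma Phi_bij: "bij_betw (Phi D) (O3stems (Edom D)) (stems D)"
proof (rule bij_betwI)
  show "Phi D \<in> O3stems (Edom D) \<rightarrow> stems D" using Phi_in_stems by auto
  show "stem_extension \<in> stems D \<rightarrow> O3stems (Edom D)" using stem_extension_in_O3stems by auto
  show "Phi D (stem_extension F) = F" if "F \<in> stems D" for F by (rule Phi_stem_extension[OF that])
  show "stem_extension (Phi D G) = G" if G: "G \<in> O3stems (Edom D)" for G
  proof
    fix v
    show "stem_extension (Phi D G) v = G v"
    proof (cases "v \<in> Edom D")
      case True
      then show ?thesis using O3stem_formula[OF G True] by (simp add: stem_extension_def vec_eq_iff)
    next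
      case False
      then show ?thesis using G by (simp add: stem_extension_def O3stems_def extensional_def)
    qed
  qed
qed

section \<open>Comparison of the induced functions\<close>

lemma O3_induced_iff_slice_induced:
  assumes G: "G \<in> O3stems (Edom D)"
  shows "O3_induced (Edom D) G f \<longleftrightarrow> slice_induced D (Phi D G) f"
proof
  assume ind: "O3_induced (Edom D) G f"
  show "slice_induced D (Phi D G) f"
    unfolding slice_induced_def
  proof safe
    fix a b I assume ab: "(a, b) \<in> D" and "I \<in> Ssph"
    \<comment> \<open>The slice formula is the case \<open>v = emb2 a b\<close>. The terms with J
      and IJ vanish there, so any J orthogonal to I will do.\<close>
    then obtain J where IJ: "(I, J) \<in> Npairs" using Npairs_exists by blast
    note E = emb2_in_Edom[OF ab]
    have "G (emb2 a b) $ 2 = 0" "G (emb2 a b) $ 3 = 0" using O3stem_fixed_coord[OF G E] by auto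
    then show "f (a *\<^sub>R oone + b *\<^sub>R I) = fst (Phi D G (a, b)) + omul I (snd (Phi D G (a, b)))"
      using bspec[OF bspec[OF ind[unfolded O3_induced_def] E] IJ] Phi_apply[OF ab]
      by (simp add: omul_zero_right)
  qed
next
  assume ind: "slice_induced D (Phi D G) f"
  show "O3_induced (Edom D) G f"
    unfolding O3_induced_def
  proof safe
    fix v I J assume v: "v \<in> Edom D" and IJ: "(I, J) \<in> Npairs"
    let ?r = "imnorm v"
    \<comment> \<open>K is the direction of the imaginary part of the argument. At radius 0 there is
      no direction, and I is chosen.\<close>
    define K where "K = (if ?r = 0 then I else (v$1/?r) *\<^sub>R I + (v$2/?r) *\<^sub>R J + (v$3/?r) *\<^sub>R omul I J)"
    have K: "K \<in> Ssph"
    proof (cases "?r = 0")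
      case True
      then show ?thesis using IJ by (simp add: K_def Npairs_def)
    next
      case False
      have "(v$1/?r)\<^sup>2 + (v$2/?r)\<^sup>2 + (v$3/?r)\<^sup>2 = ((v$1)\<^sup>2 + (v$2)\<^sup>2 + (v$3)\<^sup>2) / ?r\<^sup>2"
        by (simp only: power_divide add_divide_distrib)
      also have "\<dots> = 1" using False by (simp flip: imnorm_power2)
      finally show ?thesis using Npairs_combination_in_Ssph[OF IJ] False by (simp add: K_def)
    qed
    have rK: "?r *\<^sub>R K = v$1 *\<^sub>R I + v$2 *\<^sub>R J + v$3 *\<^sub>R omul I J"
    proof (cases "?r = 0")
      case True
      then show ?thesis using imnorm_eq_0[of v] by simp
    next
      case False
      then show ?thesis by (simp add: K_def scaleR_add_right)
    qed
    let ?F2 = "snd (Phi D G (v$0, ?r))"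
    have KF: "omul K ?F2 = omul I (G v $ 1) + omul J (G v $ 2) + omul (omul I J) (G v $ 3)"
    proof (cases "?r = 0")
      case True
      \<comment> \<open>At radius 0 the second component vanishes, so the choice of K has no
        effect.\<close>
      have "?F2 = 0"
        using Phi_apply[OF Edom_imnorm[OF v]] O3stem_fixed_coord[OF G emb2_in_Edom[OF Edom_imnorm[OF v]], of 1] True
        by simp
      then show ?thesis
        using O3stem_formula(2)[OF G v] by (simp add: omul_zero_right)
    next
      case False
      then show ?thesis
        using O3stem_formula(2)[OF G v] by (simp add: K_def omul_add_left omul_scaleR_left omul_scaleR_right)
    qed
    have "f (v$0 *\<^sub>R oone + ?r *\<^sub>R K) = fst (Phi D G (v$0, ?r)) + omul K ?F2"
      using ind Edom_imnorm[OF v] K unfolding slice_induced_def by blast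
    then show "f (v$0 *\<^sub>R oone + v$1 *\<^sub>R I + v$2 *\<^sub>R J + v$3 *\<^sub>R omul I J)
        = G v $ 0 + omul I (G v $ 1) + omul J (G v $ 2) + omul (omul I J) (G v $ 3)"
      unfolding rK KF using O3stem_formula(1)[OF G v] by (simp add: add.assoc)
  qed
qed

end

subsection \<open>Germs of convergent power series\<close>

text \<open>Fixing the values outside \<open>Basis\<close> at 0 makes each monomial occur exactly
  once.\<close>

definition mindex :: "('a::euclidean_space \<Rightarrow> nat) set" where
  "mindex = {\<alpha>. \<forall>i. i \<notin> Basis \<longrightarrow> \<alpha> i = 0}"

definition monom_at :: "'a::euclidean_space \<Rightarrow> ('a \<Rightarrow> nat) \<Rightarrow> real" where
  "monom_at h \<alpha> = (\<Prod>i\<in>Basis. (h \<bullet> i) ^ \<alpha> i)"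

definition mdeg :: "('a::euclidean_space \<Rightarrow> nat) \<Rightarrow> nat" where
  "mdeg \<alpha> = sum \<alpha> Basis"

text \<open>On a cube the monomials are bounded by \<open>\<rho> ^ mdeg \<alpha>\<close>, with
  equality at a corner. This ties pointwise convergence to the weighted norm.\<close>

definition cube :: "real \<Rightarrow> 'a::euclidean_space set" where
  "cube \<rho> = {h. \<forall>i\<in>Basis. \<bar>h \<bullet> i\<bar> \<le> \<rho>}"

text \<open>The weighted \<open>l1\<close> norm of the coefficients, bounded here by M, is submultiplicative and countably
  subadditive. So products and compositions need no multivariate Cauchy product formula.\<close>
definition bounded_series :: "real \<Rightarrow> real \<Rightarrow> ('a::euclidean_space \<Rightarrow> real) \<Rightarrow> bool" where
  "bounded_series \<rho> M u \<longleftrightarrow> (\<exists>c. \<exists>N\<le>M. ((\<lambda>\<alpha>. \<bar>c \<alpha>\<bar> * \<rho> ^ mdeg \<alpha>) has_sum N) mindex \<and>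
     (\<forall>h\<in>cube \<rho>. ((\<lambda>\<alpha>. c \<alpha> * monom_at h \<alpha>) has_sum u h) mindex))"

lemma abs_monom_at_le: "h \<in> cube \<rho> \<Longrightarrow> \<bar>monom_at h \<alpha>\<bar> \<le> \<rho> ^ mdeg \<alpha>"
  unfolding monom_at_def mdeg_def power_sum abs_prod cube_def
  by (rule prod_mono) (auto simp: power_abs power_mono)

lemma monom_at_add: "monom_at h (\<lambda>i. \<alpha> i + \<beta> i) = monom_at h \<alpha> * monom_at h \<beta>"
  by (simp add: monom_at_def power_add prod.distrib)

lemma mdeg_add: "mdeg (\<lambda>i. \<alpha> i + \<beta> i) = mdeg \<alpha> + mdeg \<beta>"
  by (simp add: mdeg_def sum.distrib)

lemma monom_at_const: "monom_at (\<Sum>i\<in>Basis. \<rho> *\<^sub>R i) \<alpha> = \<rho> ^ mdeg \<alpha>"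
  by (simp add: monom_at_def mdeg_def power_sum)

lemma mdeg_eq_0: "\<alpha> \<in> mindex \<Longrightarrow> mdeg \<alpha> = 0 \<Longrightarrow> \<alpha> = (\<lambda>_. 0)"
  unfolding mdeg_def mindex_def by auto

lemma cube_mono: "\<rho> \<le> \<rho>' \<Longrightarrow> cube \<rho> \<subseteq> cube \<rho>'"
  unfolding cube_def by force

lemma bounded_seriesE:
  fixes u :: "'a::euclidean_space \<Rightarrow> real"
  assumes "bounded_series \<rho> M u"
  obtains c N where "N \<le> M" "((\<lambda>\<alpha>. \<bar>c \<alpha>\<bar> * \<rho> ^ mdeg \<alpha>) has_sum N) mindex"
    "\<And>h. h \<in> cube \<rho> \<Longrightarrow> ((\<lambda>\<alpha>. c \<alpha> * monom_at h \<alpha>) has_sum u h) mindex"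
  using assms unfolding bounded_series_def by blast

lemma bounded_series_nonneg:
  fixes u :: "'a::euclidean_space \<Rightarrow> real"
  assumes "bounded_series \<rho> M u" "\<rho> > 0"
  shows "0 \<le> M"
proof -
  obtain c N where N: "N \<le> M" "((\<lambda>\<alpha>. \<bar>c \<alpha>\<bar> * \<rho> ^ mdeg \<alpha>) has_sum N) (mindex :: ('a \<Rightarrow> nat) set)"
    using bounded_seriesE[OF assms(1)] by metis
  have "0 \<le> N" by (rule has_sum_nonneg[OF N(2)]) (use assms(2) in auto)
  with N(1) show ?thesis by simp
qed

lemma bounded_series_abs_le:
  assumes "bounded_series \<rho> M u" "h \<in> cube \<rho>"
  shows "\<bar>u h\<bar> \<le> M"
proof -
  from assms obtain c N where N: "N \<le> M" "((\<lambda>\<alpha>. \<bar>c \<alpha>\<bar> * \<rho> ^ mdeg \<alpha>) has_sum N) mindex"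
    and s: "((\<lambda>\<alpha>. c \<alpha> * monom_at h \<alpha>) has_sum u h) mindex"
    unfolding bounded_series_def by blast
  have le: "norm (c \<alpha> * monom_at h \<alpha>) \<le> \<bar>c \<alpha>\<bar> * \<rho> ^ mdeg \<alpha>" for \<alpha>
    using abs_monom_at_le[OF assms(2)] by (simp add: abs_mult mult_left_mono)
  have "(\<lambda>\<alpha>. norm (c \<alpha> * monom_at h \<alpha>)) summable_on mindex"
    using has_sum_imp_summable[OF N(2)] le by (rule summable_on_comparison_test) auto
  then obtain n where n: "((\<lambda>\<alpha>. norm (c \<alpha> * monom_at h \<alpha>)) has_sum n) mindex"
    unfolding summable_on_def by blast
  have "norm (u h) \<le> n" by (rule norm_has_sum_bound[OF n s])
  also have "n \<le> N" by (rule has_sum_mono[OF n N(2)]) (rule le)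
  finally show ?thesis using N(1) by simp
qed

section \<open>Sums, products and powers of bounded series\<close>

lemma bounded_series_mono:
  assumes "bounded_series \<rho> M u" "M \<le> M'"
  shows "bounded_series \<rho> M' u"
  using assms unfolding bounded_series_def by (meson order_trans)

lemma bounded_series_shrink:
  assumes "bounded_series \<rho> M u" "0 < \<rho>'" "\<rho>' \<le> \<rho>"
  shows "bounded_series \<rho>' M u"
proof -
  from assms obtain c N where N: "N \<le> M" "((\<lambda>\<alpha>. \<bar>c \<alpha>\<bar> * \<rho> ^ mdeg \<alpha>) has_sum N) mindex"
    and s: "\<And>h. h \<in> cube \<rho> \<Longrightarrow> ((\<lambda>\<alpha>. c \<alpha> * monom_at h \<alpha>) has_sum u h) mindex"
    unfolding bounded_series_def by blast
  have le: "\<bar>c \<alpha>\<bar> * \<rho>' ^ mdeg \<alpha> \<le> \<bar>c \<alpha>\<bar> * \<rho> ^ mdeg \<alpha>" for \<alpha>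
    using assms by (intro mult_left_mono power_mono) auto
  have "(\<lambda>\<alpha>. \<bar>c \<alpha>\<bar> * \<rho>' ^ mdeg \<alpha>) summable_on mindex"
    using has_sum_imp_summable[OF N(2)] le by (rule summable_on_comparison_test) (use assms in auto)
  then obtain n where n: "((\<lambda>\<alpha>. \<bar>c \<alpha>\<bar> * \<rho>' ^ mdeg \<alpha>) has_sum n) mindex"
    unfolding summable_on_def by blast
  have "n \<le> N" by (rule has_sum_mono[OF n N(2)]) (rule le)
  with n N s cube_mono[OF assms(3)] show ?thesis
    unfolding bounded_series_def by (meson order_trans subset_iff)
qed

text \<open>A Fubini argument: the double series over \<open>K \<times> mindex\<close> converges
  absolutely, so it may be summed over K first, which yields a power series for s.\<close>

lemma bounded_series_infsum:
  assumes \<rho>: "\<rho> > 0" and u: "\<And>k. k \<in> K \<Longrightarrow> bounded_series \<rho> (M k) (u k)"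
    and M: "(M has_sum S) K"
    and s: "\<And>h. h \<in> cube \<rho> \<Longrightarrow> ((\<lambda>k. u k h) has_sum s h) K"
  shows "bounded_series \<rho> S s"
proof -
  have "\<forall>k\<in>K. \<exists>c N. N \<le> M k \<and> ((\<lambda>\<alpha>. \<bar>c \<alpha>\<bar> * \<rho> ^ mdeg \<alpha>) has_sum N) mindex \<and>
     (\<forall>h\<in>cube \<rho>. ((\<lambda>\<alpha>. c \<alpha> * monom_at h \<alpha>) has_sum u k h) mindex)"
    using u unfolding bounded_series_def by blast
  from bchoice[OF this] obtain c where "\<forall>k\<in>K. \<exists>N. N \<le> M k \<and>
     ((\<lambda>\<alpha>. \<bar>c k \<alpha>\<bar> * \<rho> ^ mdeg \<alpha>) has_sum N) mindex \<and>
     (\<forall>h\<in>cube \<rho>. ((\<lambda>\<alpha>. c k \<alpha> * monom_at h \<alpha>) has_sum u k h) mindex)" by blast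
  from bchoice[OF this] obtain N where N: "\<And>k. k \<in> K \<Longrightarrow> N k \<le> M k"
      "\<And>k. k \<in> K \<Longrightarrow> ((\<lambda>\<alpha>. \<bar>c k \<alpha>\<bar> * \<rho> ^ mdeg \<alpha>) has_sum N k) mindex"
    and c: "\<And>k h. k \<in> K \<Longrightarrow> h \<in> cube \<rho> \<Longrightarrow> ((\<lambda>\<alpha>. c k \<alpha> * monom_at h \<alpha>) has_sum u k h) mindex"
    by blast
  have N0: "0 \<le> N k" if "k \<in> K" for k
    by (rule has_sum_nonneg[OF N(2)[OF that]]) (use \<rho> in auto)
  have "N summable_on K"
    using has_sum_imp_summable[OF M] N(1) N0 by (rule summable_on_comparison_test)
  then obtain T where T: "(N has_sum T) K" unfolding summable_on_def by blast
  have TS: "T \<le> S" by (rule has_sum_mono[OF T M]) (rule N(1))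
  \<comment> \<open>A majorant of the double series that is uniform on the cube. Its total is T,
    which is at most S.\<close>
  define t where "t = (\<lambda>(k, \<alpha>). \<bar>c k \<alpha>\<bar> * \<rho> ^ mdeg \<alpha>)"
  have tN: "((\<lambda>\<alpha>. t (k, \<alpha>)) has_sum N k) mindex" if "k \<in> K" for k
    using N(2)[OF that] by (simp add: t_def)
  have t0: "0 \<le> t x" for x using \<rho> by (auto simp: t_def split: prod.split)
  have tsum: "t summable_on K \<times> mindex"
    by (rule summable_on_SigmaI[OF tN \<open>N summable_on K\<close>]) (auto simp: t0)
  have tT: "(t has_sum T) (K \<times> mindex)"
    by (rule has_sum_SigmaI[OF tN T tsum])
  then have tT': "((\<lambda>(\<alpha>, k). t (k, \<alpha>)) has_sum T) (mindex \<times> K)"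
    by (subst (asm) has_sum_swap)
  have tk: "(\<lambda>k. t (k, \<alpha>)) summable_on K" if "\<alpha> \<in> mindex" for \<alpha>
    using summable_on_SigmaD1[OF has_sum_imp_summable[OF tT'] that] .
  define w where "w \<alpha> = infsum (\<lambda>k. t (k, \<alpha>)) K" for \<alpha>
  have w: "((\<lambda>k. t (k, \<alpha>)) has_sum w \<alpha>) K" if "\<alpha> \<in> mindex" for \<alpha>
    unfolding w_def using tk[OF that] by simp
  have wT: "(w has_sum T) mindex"
    by (rule has_sum_SigmaD[OF tT']) (use w in auto)
  \<comment> \<open>The coefficients of s. Each defining sum converges because t, divided by the
    positive weight, is summable over K.\<close>
  define d where "d \<alpha> = infsum (\<lambda>k. c k \<alpha>) K" for \<alpha>
  have ck_abs: "(\<lambda>k. \<bar>c k \<alpha>\<bar>) summable_on K" if "\<alpha> \<in> mindex" for \<alpha>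
    using summable_on_cmult_right[OF tk[OF that], of "inverse (\<rho> ^ mdeg \<alpha>)"] \<rho>
    by (simp add: t_def field_simps)
  have d: "((\<lambda>k. c k \<alpha>) has_sum d \<alpha>) K" if "\<alpha> \<in> mindex" for \<alpha>
    unfolding d_def using ck_abs[OF that] summable_on_iff_abs_summable_on_real[of "\<lambda>k. c k \<alpha>" K]
    by simp
  have dw: "\<bar>d \<alpha>\<bar> * \<rho> ^ mdeg \<alpha> \<le> w \<alpha>" if "\<alpha> \<in> mindex" for \<alpha>
  proof -
    have "((\<lambda>k. norm (c k \<alpha> * \<rho> ^ mdeg \<alpha>)) has_sum w \<alpha>) K"
      using w[OF that] \<rho> by (simp add: t_def abs_mult)
    from norm_has_sum_bound[OF this has_sum_cmult_left[OF d[OF that]]]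
    show ?thesis using \<rho> by (simp add: abs_mult)
  qed
  have "(\<lambda>\<alpha>. \<bar>d \<alpha>\<bar> * \<rho> ^ mdeg \<alpha>) summable_on mindex"
    using has_sum_imp_summable[OF wT] dw by (rule summable_on_comparison_test) (use \<rho> in auto)
  then obtain n where n: "((\<lambda>\<alpha>. \<bar>d \<alpha>\<bar> * \<rho> ^ mdeg \<alpha>) has_sum n) mindex"
    unfolding summable_on_def by blast
  have "n \<le> T" by (rule has_sum_mono[OF n wT]) (rule dw)
  moreover have "((\<lambda>\<alpha>. d \<alpha> * monom_at h \<alpha>) has_sum s h) mindex" if h: "h \<in> cube \<rho>" for h
  proof -
    define f where "f = (\<lambda>(k, \<alpha>). c k \<alpha> * monom_at h \<alpha>)"
    have "norm (f x) \<le> t x" for x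
      using abs_monom_at_le[OF h] by (auto simp: f_def t_def abs_mult mult_left_mono split: prod.split)
    then have "(\<lambda>x. norm (f x)) summable_on K \<times> mindex"
      by (intro summable_on_comparison_test[OF tsum]) auto
    then have fsum: "f summable_on K \<times> mindex"
      by (rule abs_summable_summable)
    have "(f has_sum s h) (K \<times> mindex)"
      by (rule has_sum_SigmaI[OF _ s[OF h] fsum]) (use c[OF _ h] in \<open>simp add: f_def\<close>)
    then have "((\<lambda>(\<alpha>, k). f (k, \<alpha>)) has_sum s h) (mindex \<times> K)"
      by (subst (asm) has_sum_swap)
    then show ?thesis
      by (rule has_sum_SigmaD) (use d in \<open>simp add: f_def has_sum_cmult_left\<close>)
  qed
  ultimately show ?thesis
    using n TS unfolding bounded_series_def by (meson order_trans)
qed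

text \<open>Multiplication by a monomial translates the multi-indices by \<alpha>, so the weighted
  norm is multiplied exactly.\<close>

lemma bounded_series_monom_mult:
  assumes \<alpha>: "\<alpha> \<in> mindex" and v: "bounded_series \<rho> M v" and \<rho>: "\<rho> > 0"
  shows "bounded_series \<rho> (\<bar>a\<bar> * \<rho> ^ mdeg \<alpha> * M) (\<lambda>h. a * monom_at h \<alpha> * v h)"
proof -
  from v obtain c N where N: "N \<le> M" "((\<lambda>\<alpha>. \<bar>c \<alpha>\<bar> * \<rho> ^ mdeg \<alpha>) has_sum N) mindex"
    and s: "\<And>h. h \<in> cube \<rho> \<Longrightarrow> ((\<lambda>\<alpha>. c \<alpha> * monom_at h \<alpha>) has_sum v h) mindex"
    unfolding bounded_series_def by blast
  \<comment> \<open>Subtraction of naturals truncates, so indices not above \<alpha> need the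
    explicit coefficient 0.\<close>
  define d where "d \<gamma> = (if \<forall>i. \<alpha> i \<le> \<gamma> i then a * c (\<lambda>i. \<gamma> i - \<alpha> i) else 0)" for \<gamma>
  define U where "U = {\<gamma> \<in> mindex. \<forall>i. \<alpha> i \<le> \<gamma> i}"
  have shift: "(f has_sum x) mindex"
    if f: "((\<lambda>\<beta>. f (\<lambda>i. \<alpha> i + \<beta> i)) has_sum x) mindex"
      and f0: "\<And>\<gamma>. \<not> (\<forall>i. \<alpha> i \<le> \<gamma> i) \<Longrightarrow> f \<gamma> = 0" for f :: "('a \<Rightarrow> nat) \<Rightarrow> real" and x
  proof -
    have "(f has_sum x) U"
      using f
      by (subst has_sum_reindex_bij_witness[where i = "\<lambda>\<beta> i. \<alpha> i + \<beta> i" and j = "\<lambda>\<gamma> i. \<gamma> i - \<alpha> i"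
            and T = mindex and h = "\<lambda>\<beta>. f (\<lambda>i. \<alpha> i + \<beta> i)" and s' = x])
        (use \<alpha> in \<open>auto simp: U_def mindex_def\<close>)
    then show ?thesis
      by (subst has_sum_cong_neutral[where T = U and g = f]) (use f0 in \<open>auto simp: U_def\<close>)
  qed
  have "((\<lambda>\<gamma>. \<bar>d \<gamma>\<bar> * \<rho> ^ mdeg \<gamma>) has_sum (\<bar>a\<bar> * \<rho> ^ mdeg \<alpha> * N)) mindex"
  proof (rule shift)
    show "((\<lambda>\<beta>. \<bar>d (\<lambda>i. \<alpha> i + \<beta> i)\<bar> * \<rho> ^ mdeg (\<lambda>i. \<alpha> i + \<beta> i)) has_sum \<bar>a\<bar> * \<rho> ^ mdeg \<alpha> * N) mindex"
      using has_sum_cmult_right[OF N(2), of "\<bar>a\<bar> * \<rho> ^ mdeg \<alpha>"]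
      by (simp add: d_def mdeg_add power_add abs_mult mult_ac)
  qed (auto simp: d_def)
  moreover have "((\<lambda>\<gamma>. d \<gamma> * monom_at h \<gamma>) has_sum (a * monom_at h \<alpha> * v h)) mindex"
    if "h \<in> cube \<rho>" for h
  proof (rule shift)
    show "((\<lambda>\<beta>. d (\<lambda>i. \<alpha> i + \<beta> i) * monom_at h (\<lambda>i. \<alpha> i + \<beta> i)) has_sum a * monom_at h \<alpha> * v h) mindex"
      using has_sum_cmult_right[OF s[OF that], of "a * monom_at h \<alpha>"]
      by (simp add: d_def monom_at_add mult_ac)
  qed (auto simp: d_def)
  moreover have "\<bar>a\<bar> * \<rho> ^ mdeg \<alpha> * N \<le> \<bar>a\<bar> * \<rho> ^ mdeg \<alpha> * M"
    using N(1) \<rho> by (intro mult_left_mono) auto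
  ultimately show ?thesis unfolding bounded_series_def by blast
qed

text \<open>Expand only u. Each term is a monomial times v, and the bounds of the terms add
  up.\<close>

lemma bounded_series_mult:
  assumes "bounded_series \<rho> M u" "bounded_series \<rho> M' v" "\<rho> > 0"
  shows "bounded_series \<rho> (M * M') (\<lambda>h. u h * v h)"
proof -
  from assms(1) obtain c N where N: "N \<le> M" "((\<lambda>\<alpha>. \<bar>c \<alpha>\<bar> * \<rho> ^ mdeg \<alpha>) has_sum N) mindex"
    and s: "\<And>h. h \<in> cube \<rho> \<Longrightarrow> ((\<lambda>\<alpha>. c \<alpha> * monom_at h \<alpha>) has_sum u h) mindex"
    unfolding bounded_series_def by blast
  \<comment> \<open>The bounds of the terms sum to the exact value with N. Passing to M afterwards
    uses that M' is nonnegative.\<close>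
  have "bounded_series \<rho> (N * M') (\<lambda>h. u h * v h)"
  proof (rule bounded_series_infsum)
    show "bounded_series \<rho> (\<bar>c \<alpha>\<bar> * \<rho> ^ mdeg \<alpha> * M') (\<lambda>h. c \<alpha> * monom_at h \<alpha> * v h)"
      if "\<alpha> \<in> mindex" for \<alpha>
      using bounded_series_monom_mult[OF that assms(2,3)] .
    show "((\<lambda>\<alpha>. \<bar>c \<alpha>\<bar> * \<rho> ^ mdeg \<alpha> * M') has_sum N * M') mindex"
      by (rule has_sum_cmult_left[OF N(2)])
    show "((\<lambda>\<alpha>. c \<alpha> * monom_at h \<alpha> * v h) has_sum u h * v h) mindex" if "h \<in> cube \<rho>" for h
      by (rule has_sum_cmult_left[OF s[OF that]])
  qed fact
  then show ?thesis
    by (rule bounded_series_mono)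
      (use N(1) bounded_series_nonneg[OF assms(2,3)] in \<open>simp add: mult_right_mono\<close>)
qed

lemma bounded_series_const: "bounded_series \<rho> \<bar>a\<bar> (\<lambda>_. a)"
  unfolding bounded_series_def
proof (intro exI conjI ballI)
  let ?c = "\<lambda>\<alpha>. if \<alpha> = (\<lambda>_. 0) then a else 0"
  show "((\<lambda>\<alpha>. \<bar>?c \<alpha>\<bar> * \<rho> ^ mdeg \<alpha>) has_sum \<bar>a\<bar>) mindex"
    by (rule has_sum_finite_neutralI[where B = "{\<lambda>_. 0}"]) (auto simp: mindex_def mdeg_def)
  show "((\<lambda>\<alpha>. ?c \<alpha> * monom_at h \<alpha>) has_sum a) mindex" for h
    by (rule has_sum_finite_neutralI[where B = "{\<lambda>_. 0}"]) (auto simp: mindex_def monom_at_def)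
qed simp

lemma bounded_series_coord:
  assumes "i \<in> Basis" "\<rho> > 0"
  shows "bounded_series \<rho> \<rho> (\<lambda>h. h \<bullet> i)"
proof -
  let ?\<alpha> = "\<lambda>j. if j = i then 1 else 0 :: nat"
  have "?\<alpha> \<in> mindex" "mdeg ?\<alpha> = 1" "monom_at h ?\<alpha> = h \<bullet> i" for h
    using assms(1) by (auto simp: mindex_def mdeg_def monom_at_def if_distrib[of "\<lambda>n. _ ^ n"] cong: if_cong)
  with bounded_series_monom_mult[OF _ bounded_series_const[of \<rho> 1] assms(2), of ?\<alpha> 1]
  show ?thesis by simp
qed

text \<open>A sum over the two-element index set \<open>bool\<close>.\<close>

lemma bounded_series_add:
  assumes "bounded_series \<rho> M u" "bounded_series \<rho> M' v" "\<rho> > 0"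
  shows "bounded_series \<rho> (M + M') (\<lambda>h. u h + v h)"
  by (rule bounded_series_infsum[where K = "UNIV :: bool set" and M = "\<lambda>b. if b then M else M'"
        and u = "\<lambda>b. if b then u else v"])
    (use assms in \<open>auto simp: UNIV_bool intro!: has_sum_finiteI\<close>)

lemma bounded_series_power:
  assumes "bounded_series \<rho> M u" "\<rho> > 0"
  shows "bounded_series \<rho> (M ^ n) (\<lambda>h. u h ^ n)"
proof (induction n)
  case 0
  then show ?case using bounded_series_const[of \<rho> 1] by simp
next
  case (Suc n)
  then show ?case using bounded_series_mult[OF assms(1) Suc assms(2)] by simp
qed

lemma bounded_series_prod:
  assumes "finite A" "\<And>i. i \<in> A \<Longrightarrow> bounded_series \<rho> (M i) (u i)" "\<rho> > 0"
  shows "bounded_series \<rho> (\<Prod>i\<in>A. M i) (\<lambda>h. \<Prod>i\<in>A. u i h)"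
  using assms(1,2)
proof (induction A)
  case empty
  then show ?case using bounded_series_const[of \<rho> 1] by simp
next
  case (insert x A)
  then show ?case using bounded_series_mult[of \<rho> "M x" "u x"] assms(3) by simp
qed

text \<open>Without a constant term, shrinking the cube by a factor t shrinks the bound by t as well.\<close>
lemma bounded_series_small:
  assumes u: "bounded_series \<rho> M u" and \<rho>: "\<rho> > 0" and u0: "u 0 = 0" and e: "e > 0"
  obtains \<rho>' where "0 < \<rho>'" "\<rho>' \<le> \<rho>" "bounded_series \<rho>' e u"
proof -
  from u obtain c N where N: "N \<le> M" "((\<lambda>\<alpha>. \<bar>c \<alpha>\<bar> * \<rho> ^ mdeg \<alpha>) has_sum N) mindex"
    and s: "\<And>h. h \<in> cube \<rho> \<Longrightarrow> ((\<lambda>\<alpha>. c \<alpha> * monom_at h \<alpha>) has_sum u h) mindex"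
    unfolding bounded_series_def by blast
  have 0: "0 \<in> cube \<rho>" using \<rho> by (simp add: cube_def)
  \<comment> \<open>At the origin all monomials except the constant one vanish, so the value there
    is the constant coefficient.\<close>
  have "((\<lambda>\<alpha>. c \<alpha> * monom_at 0 \<alpha>) has_sum c (\<lambda>_. 0)) mindex"
  proof (rule has_sum_finite_neutralI[where B = "{\<lambda>_. 0}"])
    show "c \<alpha> * monom_at 0 \<alpha> = 0" if "\<alpha> \<in> mindex - {\<lambda>_. 0}" for \<alpha> :: "'a \<Rightarrow> nat"
      using that by (force simp: mindex_def monom_at_def)
  qed (auto simp: mindex_def monom_at_def)
  with s[OF 0] u0 have c0: "c (\<lambda>_. 0) = 0" using has_sum_unique by metis
  \<comment> \<open>The factor ensures \<open>t * M \<le> e\<close> and t at most 1. The summand 1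
    keeps the denominator positive.\<close>
  define t where "t = min 1 (e / (\<bar>M\<bar> + 1))"
  have t: "0 < t" "t \<le> 1" using e by (auto simp: t_def)
  have "t * M \<le> t * (\<bar>M\<bar> + 1)" using t by (intro mult_left_mono) auto
  also have "\<dots> \<le> e / (\<bar>M\<bar> + 1) * (\<bar>M\<bar> + 1)" by (intro mult_right_mono) (auto simp: t_def)
  also have "\<dots> = e" by simp
  finally have tM: "t * M \<le> e" .
  have le: "\<bar>c \<alpha>\<bar> * (t * \<rho>) ^ mdeg \<alpha> \<le> t * (\<bar>c \<alpha>\<bar> * \<rho> ^ mdeg \<alpha>)" if "\<alpha> \<in> mindex" for \<alpha>
  proof (cases "mdeg \<alpha> = 0")
    case True
    then show ?thesis using mdeg_eq_0[OF that] c0 by simp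
  next
    case False
    then have "t ^ mdeg \<alpha> \<le> t ^ 1" using t by (intro power_decreasing) auto
    then have "(\<bar>c \<alpha>\<bar> * \<rho> ^ mdeg \<alpha>) * t ^ mdeg \<alpha> \<le> (\<bar>c \<alpha>\<bar> * \<rho> ^ mdeg \<alpha>) * t"
      using \<rho> by (intro mult_left_mono) auto
    then show ?thesis by (simp add: power_mult_distrib mult_ac)
  qed
  note tN = has_sum_cmult_right[OF N(2), of t]
  have "(\<lambda>\<alpha>. \<bar>c \<alpha>\<bar> * (t * \<rho>) ^ mdeg \<alpha>) summable_on mindex"
    using has_sum_imp_summable[OF tN] le by (rule summable_on_comparison_test) (use \<rho> t in auto)
  then obtain n where n: "((\<lambda>\<alpha>. \<bar>c \<alpha>\<bar> * (t * \<rho>) ^ mdeg \<alpha>) has_sum n) mindex"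
    unfolding summable_on_def by blast
  have "n \<le> t * N" by (rule has_sum_mono[OF n tN]) (rule le)
  also have "\<dots> \<le> t * M" using t N(1) by simp
  finally have "n \<le> e" using tM by simp
  have t\<rho>: "t * \<rho> \<le> \<rho>" using t \<rho> by simp
  have "bounded_series (t * \<rho>) e u"
    unfolding bounded_series_def using n \<open>n \<le> e\<close> s cube_mono[OF t\<rho>] by blast
  then show thesis using that[of "t * \<rho>"] t \<rho> t\<rho> by simp
qed

section \<open>Germs at the origin\<close>

definition analytic_germ :: "('a::euclidean_space \<Rightarrow> real) \<Rightarrow> bool" where
  "analytic_germ u \<longleftrightarrow> (\<exists>\<rho>>0. \<exists>M. bounded_series \<rho> M u)"

lemma analytic_germ_const: "analytic_germ (\<lambda>_. a)"
  unfolding analytic_germ_def using bounded_series_const[of 1 a] zero_less_one by blast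

lemma analytic_germ_coord: "i \<in> Basis \<Longrightarrow> analytic_germ (\<lambda>h. h \<bullet> i)"
  unfolding analytic_germ_def using bounded_series_coord[of i 1] zero_less_one by blast

lemma analytic_germ_common:
  assumes "analytic_germ u" "analytic_germ v"
  obtains \<rho> M M' where "\<rho> > 0" "bounded_series \<rho> M u" "bounded_series \<rho> M' v"
proof -
  from assms obtain \<rho> M \<rho>' M' where *: "\<rho> > 0" "bounded_series \<rho> M u" "\<rho>' > 0" "bounded_series \<rho>' M' v"
    unfolding analytic_germ_def by blast
  show thesis
    by (rule that[of "min \<rho> \<rho>'" M M'])
      (use * in \<open>auto intro: bounded_series_shrink\<close>)
qed

lemma analytic_germ_add: "analytic_germ u \<Longrightarrow> analytic_germ v \<Longrightarrow> analytic_germ (\<lambda>h. u h + v h)"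
  by (metis analytic_germ_common analytic_germ_def bounded_series_add)

lemma analytic_germ_mult: "analytic_germ u \<Longrightarrow> analytic_germ v \<Longrightarrow> analytic_germ (\<lambda>h. u h * v h)"
  by (metis analytic_germ_common analytic_germ_def bounded_series_mult)

lemma analytic_germ_power: "analytic_germ u \<Longrightarrow> analytic_germ (\<lambda>h. u h ^ n)"
  by (metis analytic_germ_def bounded_series_power)

lemma analytic_germ_diff: "analytic_germ u \<Longrightarrow> analytic_germ v \<Longrightarrow> analytic_germ (\<lambda>h. u h - v h)"
  using analytic_germ_add[of u "\<lambda>h. (-1) * v h"] analytic_germ_mult[OF analytic_germ_const, of v "-1"]
  by simp

lemma cube_subset_ball:
  assumes "r > 0"
  obtains \<rho> where "\<rho> > 0" "(cube \<rho> :: 'a::euclidean_space set) \<subseteq> ball 0 r"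
proof
  define \<rho> where "\<rho> = r / (2 * DIM('a))"
  show "\<rho> > 0" using assms by (simp add: \<rho>_def)
  show "(cube \<rho> :: 'a set) \<subseteq> ball 0 r"
  proof
    fix h :: 'a assume "h \<in> cube \<rho>"
    have "norm h \<le> (\<Sum>i\<in>Basis. \<bar>h \<bullet> i\<bar>)" by (rule norm_le_l1)
    also have "\<dots> \<le> (\<Sum>i\<in>(Basis::'a set). \<rho>)"
      using \<open>h \<in> cube \<rho>\<close> by (intro sum_mono) (auto simp: cube_def)
    also have "\<dots> = r / 2" by (simp add: \<rho>_def)
    finally show "h \<in> ball 0 r" using assms by simp
  qed
qed

lemma ball_subset_cube: "ball 0 \<rho> \<subseteq> cube \<rho>"
  unfolding cube_def by (auto intro: order_trans[OF Basis_le_norm])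

lemma analytic_germ_cong:
  assumes "analytic_germ u" "eventually (\<lambda>h. u h = v h) (nhds 0)"
  shows "analytic_germ v"
proof -
  from assms(1) obtain \<rho> M where \<rho>: "\<rho> > 0" and u: "bounded_series \<rho> M u"
    unfolding analytic_germ_def by blast
  from assms(2) obtain r where r: "r > 0" "\<And>h. h \<in> ball 0 r \<Longrightarrow> u h = v h"
    unfolding eventually_nhds_metric by (auto simp: dist_commute)
  obtain \<rho>' where \<rho>': "\<rho>' > 0" "(cube \<rho>' :: 'a set) \<subseteq> ball 0 r" by (rule cube_subset_ball[OF r(1)])
  let ?\<rho> = "min \<rho> \<rho>'"
  have "bounded_series ?\<rho> M u" using u \<rho> \<rho>' by (auto intro: bounded_series_shrink)
  moreover have "u h = v h" if "h \<in> cube ?\<rho>" for h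
    using that cube_mono[of ?\<rho> \<rho>'] \<rho>'(2) r(2) by auto
  ultimately have "bounded_series ?\<rho> M v" unfolding bounded_series_def by auto
  then show ?thesis using \<rho> \<rho>' unfolding analytic_germ_def by (metis min_less_iff_conj)
qed

text \<open>Convergence at the corner of a cube inside the ball means summability of
  \<open>c \<alpha> * \<rho> ^ mdeg \<alpha>\<close>. Unconditional real sums converge absolutely,
  so the weighted norm is finite.\<close>

lemma analytic_germ_iff:
  "analytic_germ u \<longleftrightarrow> (\<exists>r>0. \<exists>c. \<forall>h\<in>ball 0 r. ((\<lambda>\<alpha>. c \<alpha> * monom_at h \<alpha>) has_sum u h) mindex)"
    (is "_ \<longleftrightarrow> ?R")
proof
  show ?R if "analytic_germ u"
    using that ball_subset_cube unfolding analytic_germ_def bounded_series_def by blast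
next
  assume ?R
  then obtain r c where r: "r > 0" and c: "\<And>h. h \<in> ball 0 r \<Longrightarrow> ((\<lambda>\<alpha>. c \<alpha> * monom_at h \<alpha>) has_sum u h) mindex"
    by blast
  obtain \<rho> where \<rho>: "\<rho> > 0" "(cube \<rho> :: 'a set) \<subseteq> ball 0 r" by (rule cube_subset_ball[OF r])
  have "(\<Sum>i\<in>Basis. \<rho> *\<^sub>R i) \<in> (cube \<rho> :: 'a set)" using \<rho>(1) by (simp add: cube_def)
  then have "(\<lambda>\<alpha>. c \<alpha> * \<rho> ^ mdeg \<alpha>) summable_on mindex"
    using c \<rho>(2) monom_at_const[of \<rho>] has_sum_imp_summable by (metis (no_types, lifting) subsetD summable_on_cong)
  then have "(\<lambda>\<alpha>. \<bar>c \<alpha>\<bar> * \<rho> ^ mdeg \<alpha>) summable_on mindex"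
    using \<rho>(1) by (subst (asm) summable_on_iff_abs_summable_on_real) (simp add: abs_mult)
  then obtain N where "((\<lambda>\<alpha>. \<bar>c \<alpha>\<bar> * \<rho> ^ mdeg \<alpha>) has_sum N) mindex" unfolding summable_on_def by blast
  then have "bounded_series \<rho> N u" unfolding bounded_series_def using c \<rho>(2) by blast
  then show "analytic_germ u" unfolding analytic_germ_def using \<rho>(1) by blast
qed

text \<open>Translation by p moves each base point to the origin.\<close>

lemma real_analytic_on_iff_germ:
  fixes f :: "'a::euclidean_space \<Rightarrow> 'b::euclidean_space"
  shows "real_analytic_on f S \<longleftrightarrow> (\<forall>e\<in>Basis. \<forall>p\<in>S. analytic_germ (\<lambda>h. f (p + h) \<bullet> e))"
proof -
  have *: "(\<forall>x\<in>ball p r. P x (x - p)) \<longleftrightarrow> (\<forall>h\<in>ball 0 r. P (p + h) h)" for p :: 'a and r P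
  proof safe
    fix x :: 'a assume "\<forall>h\<in>ball 0 r. P (p + h) h" "x \<in> ball p r"
    then show "P x (x - p)" by (auto simp: dist_norm norm_minus_commute dest!: bspec[of _ _ "x - p"])
  next
    fix h :: 'a assume "\<forall>x\<in>ball p r. P x (x - p)" "h \<in> ball 0 r"
    then show "P (p + h) h" by (auto simp: dist_norm dest!: bspec[of _ _ "p + h"])
  qed
  show ?thesis
    unfolding real_analytic_on_def analytic_germ_iff monom_at_def mindex_def
    by (subst *[where P = "\<lambda>x h. ((\<lambda>\<alpha>. c \<alpha> * (\<Prod>i\<in>Basis. (h \<bullet> i) ^ \<alpha> i)) has_sum f x \<bullet> e) A" for c e A])
      (rule refl)
qed

section \<open>Composition and real powers of germs\<close>

lemma bounded_series_common:
  assumes "\<And>i. i \<in> A \<Longrightarrow> analytic_germ (u i)" "\<And>i. i \<in> A \<Longrightarrow> u i 0 = 0" "finite A" "e > 0"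
  obtains \<rho> where "\<rho> > 0" "\<And>i. i \<in> A \<Longrightarrow> bounded_series \<rho> e (u i)"
proof -
  have "\<exists>\<rho>>0. bounded_series \<rho> e (u i)" if "i \<in> A" for i
    using assms(1,2)[OF that] bounded_series_small assms(4) unfolding analytic_germ_def by metis
  then obtain \<rho> where \<rho>: "\<And>i. i \<in> A \<Longrightarrow> \<rho> i > 0 \<and> bounded_series (\<rho> i) e (u i)" by metis
  \<comment> \<open>The extra element 1 keeps the minimum defined when A is empty.\<close>
  define m where "m = Min (insert 1 (\<rho> ` A))"
  have "m > 0" using \<rho> assms(3) by (auto simp: m_def)
  moreover have "m \<le> \<rho> i" if "i \<in> A" for i using assms(3) that by (auto simp: m_def)
  ultimately show thesis using that[of m] \<rho> bounded_series_shrink by meson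
qed

text \<open>Since u vanishes at 0, its coordinates have bound \<sigma> on a small cube. A monomial
  in them then has bound \<open>\<sigma> ^ mdeg \<alpha>\<close>, so the substituted series has
  bound N.\<close>

lemma analytic_germ_compose:
  fixes u :: "'a::euclidean_space \<Rightarrow> 'b::euclidean_space"
  assumes g: "analytic_germ g" and u: "\<And>i. i \<in> Basis \<Longrightarrow> analytic_germ (\<lambda>h. u h \<bullet> i)" and u0: "u 0 = 0"
  shows "analytic_germ (\<lambda>h. g (u h))"
proof -
  from g obtain \<sigma> c N where \<sigma>: "\<sigma> > 0" and N: "((\<lambda>\<alpha>. \<bar>c \<alpha>\<bar> * \<sigma> ^ mdeg \<alpha>) has_sum N) mindex"
    and c: "\<And>h. h \<in> cube \<sigma> \<Longrightarrow> ((\<lambda>\<alpha>. c \<alpha> * monom_at h \<alpha>) has_sum g h) mindex"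
    unfolding analytic_germ_def bounded_series_def by blast
  obtain \<rho> where \<rho>: "\<rho> > 0" and b: "\<And>i. i \<in> Basis \<Longrightarrow> bounded_series \<rho> \<sigma> (\<lambda>h. u h \<bullet> i)"
    using bounded_series_common[of "Basis :: 'b set" "\<lambda>i h. u h \<bullet> i" \<sigma>] u u0 \<sigma> by auto
  have "bounded_series \<rho> N (\<lambda>h. g (u h))"
  proof (rule bounded_series_infsum[OF \<rho> _ N])
    fix \<alpha> :: "'b \<Rightarrow> nat"
    have "bounded_series \<rho> (\<Prod>i\<in>Basis. \<sigma> ^ \<alpha> i) (\<lambda>h. monom_at (u h) \<alpha>)"
      unfolding monom_at_def using bounded_series_power[OF b \<rho>] \<rho> by (intro bounded_series_prod) auto
    from bounded_series_mult[OF bounded_series_const this \<rho>, of "c \<alpha>"]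
    show "bounded_series \<rho> (\<bar>c \<alpha>\<bar> * \<sigma> ^ mdeg \<alpha>) (\<lambda>h. c \<alpha> * monom_at (u h) \<alpha>)"
      by (simp add: mdeg_def power_sum)
  next
    fix h :: 'a assume "h \<in> cube \<rho>"
    then have "u h \<in> cube \<sigma>" using bounded_series_abs_le[OF b] by (simp add: cube_def)
    then show "((\<lambda>\<alpha>. c \<alpha> * monom_at (u h) \<alpha>) has_sum g (u h)) mindex" by (rule c)
  qed
  then show ?thesis using \<rho> unfolding analytic_germ_def by blast
qed

lemma analytic_germ_powser:
  fixes \<phi> :: "real \<Rightarrow> real"
  assumes R: "R > 0" and \<phi>: "\<And>z. \<bar>z\<bar> < R \<Longrightarrow> (\<lambda>n. a n * z ^ n) sums \<phi> z"
  shows "analytic_germ \<phi>"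
proof -
  have "((\<lambda>\<alpha>. a (\<alpha> 1) * monom_at z \<alpha>) has_sum \<phi> z) mindex" if "z \<in> ball 0 R" for z
  proof -
    from that have z: "\<bar>z\<bar> < R" by simp
    \<comment> \<open>A point strictly between |z| and R: convergence at K gives absolute
      convergence at z.\<close>
    define K where "K = (\<bar>z\<bar> + R) / 2"
    have K: "\<bar>z\<bar> < \<bar>K\<bar>" "\<bar>K\<bar> < R" using z R by (auto simp: K_def abs_of_pos add_nonneg_pos)
    have "summable (\<lambda>n. a n * K ^ n)" using \<phi>[OF K(2)] by (rule sums_summable)
    then have "summable (\<lambda>n. norm (a n * z ^ n))"
      by (rule powser_insidea) (use K in simp)
    then have "((\<lambda>n. a n * z ^ n) has_sum \<phi> z) UNIV"
      using \<phi>[OF z] by (rule norm_summable_imp_has_sum)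
    \<comment> \<open>The only basis vector of the reals is 1, so a multi-index amounts to its value
      there.\<close>
    then show ?thesis 
      by (subst has_sum_reindex_bij_witness[where i = "\<lambda>n i. if i = 1 then n else 0" and j = "\<lambda>\<alpha>. \<alpha> 1"
            and T = UNIV and h = "\<lambda>n. a n * z ^ n" and s' = "\<phi> z"])
        (auto simp: mindex_def monom_at_def)
  qed
  then show ?thesis
    unfolding analytic_germ_iff using R by (intro exI[of _ R] conjI exI[of _ "\<lambda>\<alpha>. a (\<alpha> 1)"] ballI)
qed

text \<open>Write q as \<open>q 0 * (1 + z)\<close>, where z is a germ vanishing at 0, and insert z
  into the binomial series. The exponents 1/2 and -1/2 give the radius and its inverse.\<close>

lemma analytic_germ_powr:
  assumes q: "analytic_germ q" and q0: "q 0 > 0" and nonneg: "\<And>h. q h \<ge> 0"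
  shows "analytic_germ (\<lambda>h. q h powr a)"
proof -
  have "analytic_germ (\<lambda>z::real. (1 + z) powr a)"
    by (rule analytic_germ_powser[of 1 "\<lambda>n. a gchoose n"]) (auto intro: gen_binomial_real)
  moreover have "analytic_germ (\<lambda>h. (1 / q 0) * q h - 1)"
    by (intro analytic_germ_diff analytic_germ_mult analytic_germ_const q)
  ultimately have "analytic_germ (\<lambda>h. (1 + ((1 / q 0) * q h - 1)) powr a)"
    using analytic_germ_compose[of "\<lambda>z. (1 + z) powr a" "\<lambda>h. (1 / q 0) * q h - 1"] q0 by simp
  then have "analytic_germ (\<lambda>h. q 0 powr a * (1 + ((1 / q 0) * q h - 1)) powr a)"
    by (intro analytic_germ_mult analytic_germ_const)
  moreover have "q 0 powr a * (1 + ((1 / q 0) * q h - 1)) powr a = q h powr a" for h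
    using q0 nonneg[of h] by (subst powr_mult[symmetric]) auto
  ultimately show ?thesis by simp
qed

section \<open>Parity and square roots\<close>

lemma monom_at_pair: "monom_at (s, t) \<alpha> = s ^ \<alpha> (1, 0) * t ^ \<alpha> (0, 1)" for s t :: real
  by (simp add: monom_at_def Basis_prod_def)

lemma mdeg_pair: "mdeg \<alpha> = \<alpha> (1, 0) + \<alpha> (0, 1 :: real)" for \<alpha> :: "real \<times> real \<Rightarrow> nat"
  by (simp add: mdeg_def Basis_prod_def)

lemma cube_pair: "(s, t) \<in> cube \<sigma> \<longleftrightarrow> \<bar>s\<bar> \<le> \<sigma> \<and> \<bar>t\<bar> \<le> \<sigma>" for s t :: real
  by (auto simp: cube_def Basis_prod_def)

text \<open>Provides a single closed square on which both the expansion and the local property P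
  hold. In the applications P is a parity identity.\<close>

lemma analytic_germ_pairE:
  fixes g :: "real \<times> real \<Rightarrow> real"
  assumes g: "analytic_germ g" and P: "eventually P (nhds 0)"
  obtains \<sigma> N and c :: "(real \<times> real \<Rightarrow> nat) \<Rightarrow> real" where "\<sigma> > 0" "((\<lambda>\<alpha>. \<bar>c \<alpha>\<bar> * \<sigma> ^ mdeg \<alpha>) has_sum N) mindex"
    "\<And>s t. \<bar>s\<bar> \<le> \<sigma> \<Longrightarrow> \<bar>t\<bar> \<le> \<sigma> \<Longrightarrow> P (s, t)"
    "\<And>s t. \<bar>s\<bar> \<le> \<sigma> \<Longrightarrow> \<bar>t\<bar> \<le> \<sigma> \<Longrightarrow>
       ((\<lambda>\<alpha>. c \<alpha> * s ^ \<alpha> (1, 0) * t ^ \<alpha> (0, 1)) has_sum g (s, t)) mindex"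
proof -
  from g obtain \<rho> M where \<rho>: "\<rho> > 0" and b: "bounded_series \<rho> M g"
    unfolding analytic_germ_def by blast
  from P obtain r where r: "r > 0" "\<And>x. x \<in> ball 0 r \<Longrightarrow> P x"
    unfolding eventually_nhds_metric by (auto simp: dist_commute)
  obtain \<rho>' where \<rho>': "\<rho>' > 0" "(cube \<rho>' :: (real \<times> real) set) \<subseteq> ball 0 r"
    by (rule cube_subset_ball[OF r(1)])
  define \<sigma> where "\<sigma> = min \<rho> \<rho>'"
  have \<sigma>: "\<sigma> > 0" using \<rho> \<rho>' by (simp add: \<sigma>_def)
  have "bounded_series \<sigma> M g" using b \<sigma> by (rule bounded_series_shrink) (simp add: \<sigma>_def)
  then obtain N and c :: "(real \<times> real \<Rightarrow> nat) \<Rightarrow> real" where N: "((\<lambda>\<alpha>. \<bar>c \<alpha>\<bar> * \<sigma> ^ mdeg \<alpha>) has_sum N) mindex"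
    and c: "\<And>h. h \<in> cube \<sigma> \<Longrightarrow> ((\<lambda>\<alpha>. c \<alpha> * monom_at h \<alpha>) has_sum g h) mindex"
    unfolding bounded_series_def by blast
  show thesis
  proof (rule that[OF \<sigma> N])
    fix s t :: real assume "\<bar>s\<bar> \<le> \<sigma>" "\<bar>t\<bar> \<le> \<sigma>"
    then have "(s, t) \<in> cube \<sigma>" by (simp add: cube_pair)
    from c[OF this] show "((\<lambda>\<alpha>. c \<alpha> * s ^ \<alpha> (1, 0) * t ^ \<alpha> (0, 1)) has_sum g (s, t)) mindex"
      by (simp add: monom_at_pair mult.assoc)
    have "cube \<sigma> \<subseteq> (cube \<rho>' :: (real \<times> real) set)" by (rule cube_mono) (simp add: \<sigma>_def)
    then show "P (s, t)" using \<open>(s, t) \<in> cube \<sigma>\<close> \<rho>'(2) r(2) by blast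
  qed
qed

text \<open>Evenness kills the odd powers of the second variable, and an even power of the
  square root of q is a power of q. Note that q may vanish, where the square root is not analytic.\<close>
lemma analytic_germ_even_sqrt:
  fixes g :: "real \<times> real \<Rightarrow> real"
  assumes g: "analytic_germ g" and even: "eventually (\<lambda>x. g (fst x, - snd x) = g x) (nhds 0)"
    and w: "analytic_germ w" "w 0 = 0" and q: "analytic_germ q" "q 0 = 0" "\<And>h. q h \<ge> 0"
  shows "analytic_germ (\<lambda>h. g (w h, sqrt (q h)))"
proof -
  obtain \<sigma> N and c :: "(real \<times> real \<Rightarrow> nat) \<Rightarrow> real"
    where \<sigma>: "\<sigma> > 0" and N: "((\<lambda>\<alpha>. \<bar>c \<alpha>\<bar> * \<sigma> ^ mdeg \<alpha>) has_sum N) mindex"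
    and ev: "\<And>s t. \<bar>s\<bar> \<le> \<sigma> \<Longrightarrow> \<bar>t\<bar> \<le> \<sigma> \<Longrightarrow> g (fst (s, t), - snd (s, t)) = g (s, t)"
    and c: "\<And>s t. \<bar>s\<bar> \<le> \<sigma> \<Longrightarrow> \<bar>t\<bar> \<le> \<sigma> \<Longrightarrow>
       ((\<lambda>\<alpha>. c \<alpha> * s ^ \<alpha> (1, 0) * t ^ \<alpha> (0, 1)) has_sum g (s, t)) mindex"
    by (rule analytic_germ_pairE[OF g even]) (rule that)
  \<comment> \<open>The bound \<sigma> is meant for w and its square for q, so that the square root
    of q again stays within \<sigma>.\<close>
  obtain \<rho> where \<rho>: "\<rho> > 0" and b: "\<And>f. f \<in> {w, q} \<Longrightarrow> bounded_series \<rho> (min \<sigma> (\<sigma>\<^sup>2)) f"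
    using bounded_series_common[of "{w, q}" "\<lambda>f. f" "min \<sigma> (\<sigma>\<^sup>2)"] w q \<sigma> by auto
  have bw: "bounded_series \<rho> \<sigma> w" and bq: "bounded_series \<rho> (\<sigma>\<^sup>2) q"
    using bounded_series_mono[OF b[of w], of \<sigma>] bounded_series_mono[OF b[of q], of "\<sigma>\<^sup>2"] by auto
  define T where "T \<alpha> h = (if even (\<alpha> (0, 1)) then c \<alpha> * (w h ^ \<alpha> (1, 0) * q h ^ (\<alpha> (0, 1) div 2)) else 0)" for \<alpha> h
  have "bounded_series \<rho> N (\<lambda>h. g (w h, sqrt (q h)))"
  proof (rule bounded_series_infsum[OF \<rho> _ N])
    fix \<alpha> :: "real \<times> real \<Rightarrow> nat"
    show "bounded_series \<rho> (\<bar>c \<alpha>\<bar> * \<sigma> ^ mdeg \<alpha>) (T \<alpha>)"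
    proof (cases "even (\<alpha> (0, 1))")
      case True
      have "bounded_series \<rho> (\<bar>c \<alpha>\<bar> * (\<sigma> ^ \<alpha> (1, 0) * (\<sigma>\<^sup>2) ^ (\<alpha> (0, 1) div 2))) (T \<alpha>)"
        unfolding T_def using True \<rho> bw bq
        by (auto intro!: bounded_series_mult bounded_series_const bounded_series_power)
      then show ?thesis using True by (simp add: mdeg_pair power_add power_mult[symmetric])
    next
      case False
      then have "T \<alpha> = (\<lambda>_. 0)" by (simp add: T_def fun_eq_iff)
      then show ?thesis using \<sigma> by (simp add: bounded_series_mono[OF bounded_series_const[of \<rho> 0]] less_imp_le)
    qed
  next
    fix h :: 'a assume h: "h \<in> cube \<rho>"
    let ?s = "w h" and ?t = "sqrt (q h)"
    have s: "\<bar>?s\<bar> \<le> \<sigma>" using bounded_series_abs_le[OF bw h] .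
    have t: "\<bar>?t\<bar> \<le> \<sigma>"
      using bounded_series_abs_le[OF bq h] \<sigma> q(3)[of h] by (simp add: real_le_lsqrt)
    \<comment> \<open>Averaging the series at t and -t leaves g unchanged by evenness and cancels
      the odd powers, which turns each term into \<open>T \<alpha> h\<close>.\<close>
    have "((\<lambda>\<alpha>. 1/2 * (c \<alpha> * ?s ^ \<alpha> (1, 0) * ?t ^ \<alpha> (0, 1) + c \<alpha> * ?s ^ \<alpha> (1, 0) * (- ?t) ^ \<alpha> (0, 1)))
       has_sum 1/2 * (g (?s, ?t) + g (?s, - ?t))) mindex"
      by (intro has_sum_cmult_right has_sum_add c s) (use t in auto)
    moreover have "1/2 * (g (?s, ?t) + g (?s, - ?t)) = g (?s, ?t)" using ev[OF s t] by simp
    moreover have "1/2 * (c \<alpha> * ?s ^ \<alpha> (1, 0) * ?t ^ \<alpha> (0, 1) + c \<alpha> * ?s ^ \<alpha> (1, 0) * (- ?t) ^ \<alpha> (0, 1)) = T \<alpha> h" for \<alpha>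
    proof (cases "even (\<alpha> (0, 1))")
      case True
      then obtain k where k: "\<alpha> (0, 1) = 2 * k" by blast
      then show ?thesis using q(3)[of h] by (simp add: T_def power_mult)
    qed (simp add: T_def)
    ultimately show "((\<lambda>\<alpha>. T \<alpha> h) has_sum g (?s, ?t)) mindex" by simp
  qed
  then show ?thesis using \<rho> unfolding analytic_germ_def by blast
qed

text \<open>Only odd powers of the root t of q survive, and x / t times the power 2k + 1 of t is x
  times the power k of q, which involves no root. In the bound, x replaces one factor t, so the
  weight \<open>\<sigma> ^ mdeg \<alpha>\<close> is kept.\<close>

lemma analytic_germ_odd_sqrt:
  fixes g :: "real \<times> real \<Rightarrow> real"
  assumes g: "analytic_germ g" and odd: "eventually (\<lambda>x. g (fst x, - snd x) = - g x) (nhds 0)"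
    and w: "analytic_germ w" "w 0 = 0" and q: "analytic_germ q" "q 0 = 0" "\<And>h. q h \<ge> 0"
    and x: "analytic_germ x" "\<And>h. q h = 0 \<Longrightarrow> x h = 0"
  shows "analytic_germ (\<lambda>h. x h / sqrt (q h) * g (w h, sqrt (q h)))"
proof -
  obtain \<sigma> N and c :: "(real \<times> real \<Rightarrow> nat) \<Rightarrow> real"
    where \<sigma>: "\<sigma> > 0" and N: "((\<lambda>\<alpha>. \<bar>c \<alpha>\<bar> * \<sigma> ^ mdeg \<alpha>) has_sum N) mindex"
    and od: "\<And>s t. \<bar>s\<bar> \<le> \<sigma> \<Longrightarrow> \<bar>t\<bar> \<le> \<sigma> \<Longrightarrow> g (fst (s, t), - snd (s, t)) = - g (s, t)"
    and c: "\<And>s t. \<bar>s\<bar> \<le> \<sigma> \<Longrightarrow> \<bar>t\<bar> \<le> \<sigma> \<Longrightarrow>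
       ((\<lambda>\<alpha>. c \<alpha> * s ^ \<alpha> (1, 0) * t ^ \<alpha> (0, 1)) has_sum g (s, t)) mindex"
    by (rule analytic_germ_pairE[OF g odd]) (rule that)
  have x0: "x 0 = 0" using x(2) q(2) by simp
  obtain \<rho> where \<rho>: "\<rho> > 0" and b: "\<And>f. f \<in> {w, q, x} \<Longrightarrow> bounded_series \<rho> (min \<sigma> (\<sigma>\<^sup>2)) f"
    using bounded_series_common[of "{w, q, x}" "\<lambda>f. f" "min \<sigma> (\<sigma>\<^sup>2)"] w q x(1) x0 \<sigma> by auto
  have bw: "bounded_series \<rho> \<sigma> w" and bq: "bounded_series \<rho> (\<sigma>\<^sup>2) q" and bx: "bounded_series \<rho> \<sigma> x"
    using bounded_series_mono[OF b[of w], of \<sigma>] bounded_series_mono[OF b[of q], of "\<sigma>\<^sup>2"]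
      bounded_series_mono[OF b[of x], of \<sigma>] by auto
  define T where "T \<alpha> h = (if odd (\<alpha> (0, 1)) then c \<alpha> * (w h ^ \<alpha> (1, 0) * (q h ^ (\<alpha> (0, 1) div 2) * x h)) else 0)" for \<alpha> h
  have "bounded_series \<rho> N (\<lambda>h. x h / sqrt (q h) * g (w h, sqrt (q h)))"
  proof (rule bounded_series_infsum[OF \<rho> _ N])
    fix \<alpha> :: "real \<times> real \<Rightarrow> nat"
    show "bounded_series \<rho> (\<bar>c \<alpha>\<bar> * \<sigma> ^ mdeg \<alpha>) (T \<alpha>)"
    proof (cases "odd (\<alpha> (0, 1))")
      case True
      have "bounded_series \<rho> (\<bar>c \<alpha>\<bar> * (\<sigma> ^ \<alpha> (1, 0) * ((\<sigma>\<^sup>2) ^ (\<alpha> (0, 1) div 2) * \<sigma>))) (T \<alpha>)"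
        unfolding T_def using True \<rho> bw bq bx
        by (auto intro!: bounded_series_mult bounded_series_const bounded_series_power)
      moreover obtain k where "\<alpha> (0, 1) = 2 * k + 1" using True by (auto elim: oddE)
      ultimately show ?thesis by (simp add: mdeg_pair power_add power_mult[symmetric] mult_ac)
    next
      case False
      then have "T \<alpha> = (\<lambda>_. 0)" by (simp add: T_def fun_eq_iff)
      then show ?thesis using \<sigma> by (simp add: bounded_series_mono[OF bounded_series_const[of \<rho> 0]] less_imp_le)
    qed
  next
    fix h :: 'a assume h: "h \<in> cube \<rho>"
    let ?s = "w h" and ?t = "sqrt (q h)"
    have s: "\<bar>?s\<bar> \<le> \<sigma>" using bounded_series_abs_le[OF bw h] .
    have t: "\<bar>?t\<bar> \<le> \<sigma>"
      using bounded_series_abs_le[OF bq h] \<sigma> q(3)[of h] by (simp add: real_le_lsqrt)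
    \<comment> \<open>Half the difference of the series at t and -t keeps g by oddness and cancels
      the even powers.\<close>
    have "((\<lambda>\<alpha>. x h / ?t * (1/2 * (c \<alpha> * ?s ^ \<alpha> (1, 0) * ?t ^ \<alpha> (0, 1) - c \<alpha> * ?s ^ \<alpha> (1, 0) * (- ?t) ^ \<alpha> (0, 1))))
       has_sum x h / ?t * (1/2 * (g (?s, ?t) - g (?s, - ?t)))) mindex"
      unfolding diff_conv_add_uminus
      by (intro has_sum_cmult_right has_sum_add has_sum_uminusI c s) (use t in auto)
    moreover have "1/2 * (g (?s, ?t) - g (?s, - ?t)) = g (?s, ?t)" using od[OF s t] by simp
    moreover have "x h / ?t * (1/2 * (c \<alpha> * ?s ^ \<alpha> (1, 0) * ?t ^ \<alpha> (0, 1) - c \<alpha> * ?s ^ \<alpha> (1, 0) * (- ?t) ^ \<alpha> (0, 1))) = T \<alpha> h" for \<alpha>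
    proof (cases "odd (\<alpha> (0, 1))")
      case True
      then obtain k where k: "\<alpha> (0, 1) = 2 * k + 1" by (auto elim: oddE)
      then have "\<alpha> (0, 1) = Suc (2 * k)" by simp
      \<comment> \<open>Where q vanishes, so does x, and both sides are 0.\<close>
      then show ?thesis using q(3)[of h] x(2)[of h]
        by (cases "q h = 0") (simp_all add: T_def power_mult)
    qed (simp add: T_def)
    ultimately show "((\<lambda>\<alpha>. T \<alpha> h) has_sum x h / ?t * g (?s, ?t)) mindex" by (simp only:)
  qed
  then show ?thesis using \<rho> unfolding analytic_germ_def by blast
qed

subsection \<open>Analyticity of stem functions\<close>

lemma eventually_add_mem_open:
  fixes p :: "'a::real_normed_vector"
  assumes "open S" "p \<in> S"
  shows "eventually (\<lambda>h. p + h \<in> S) (nhds 0)"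
proof -
  have "((\<lambda>h. p + h) \<longlongrightarrow> p + 0) (nhds 0)" by (intro tendsto_intros filterlim_ident)
  then show ?thesis using topological_tendstoD[of _ "p + 0"] assms by auto
qed

lemma open_Edom:
  assumes "open D"
  shows "open (Edom D)"
proof -
  have "Edom D = (\<lambda>x. (x$0, sqrt ((x$1)\<^sup>2 + (x$2)\<^sup>2 + (x$3)\<^sup>2))) -` D"
    by (auto simp: Edom_def)
  then show ?thesis using assms by (simp, intro open_vimage continuous_intros)
qed

lemma analytic_germ_nth: "analytic_germ (\<lambda>h::real^'n. h $ i)"
  using analytic_germ_coord[of "axis i 1 :: real^'n"] by (simp add: inner_axis axis_in_Basis_iff)

lemma analytic_germ_nth_add: "analytic_germ (\<lambda>h::real^'n. (p + h) $ i)"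
  using analytic_germ_add[OF analytic_germ_const analytic_germ_nth, of "p $ i" i] by simp

lemma analytic_germ_pair:
  assumes "analytic_germ g" "analytic_germ s" "analytic_germ t" "s 0 = 0" "t 0 = (0::real)"
  shows "analytic_germ (\<lambda>h. g (s h :: real, t h))"
  by (rule analytic_germ_compose[of g "\<lambda>h. (s h, t h)"])
    (use assms in \<open>auto simp: Basis_prod_def zero_prod_def\<close>)

context
  fixes D :: "(real \<times> real) set" and p :: "real^4" and F :: "real \<times> real \<Rightarrow> oct \<times> oct" and e :: oct
  assumes p: "p \<in> Edom D" and F: "F \<in> stems D" and an: "real_analytic_on F D" and e: "e \<in> Basis"
    and D: "open D"
begin

text \<open>The squared radius is a polynomial in h, hence analytic even where the radius
  vanishes.\<close>

private definition q :: "real^4 \<Rightarrow> real" where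
  "q h = ((p + h)$1)\<^sup>2 + ((p + h)$2)\<^sup>2 + ((p + h)$3)\<^sup>2"

private lemma q: "analytic_germ q" "q h \<ge> 0" "sqrt (q h) = imnorm (p + h)"
  unfolding q_def imnorm_def
  by (intro analytic_germ_add analytic_germ_power analytic_germ_nth_add) auto

private lemma stem_germs:
  shows "analytic_germ (\<lambda>k. fst (F ((p$0, imnorm p) + k)) \<bullet> e)"
    and "analytic_germ (\<lambda>k. snd (F ((p$0, imnorm p) + k)) \<bullet> e)"
proof -
  have "(p$0, imnorm p) \<in> D" using p by (simp add: Edom_iff)
  then have *: "analytic_germ (\<lambda>k. F ((p$0, imnorm p) + k) \<bullet> b)" if "b \<in> Basis" for b
    using an that unfolding real_analytic_on_iff_germ by blast
  show "analytic_germ (\<lambda>k. fst (F ((p$0, imnorm p) + k)) \<bullet> e)"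
    using *[of "(e, 0)"] e by (simp add: Basis_prod_def inner_prod_def)
  show "analytic_germ (\<lambda>k. snd (F ((p$0, imnorm p) + k)) \<bullet> e)"
    using *[of "(0, e)"] e by (simp add: Basis_prod_def inner_prod_def)
qed

text \<open>At positive radius, the radius and its inverse are powers of the germ \<open>q\<close>,
  and composition applies. At radius 0 the parity lemmas apply, with the first coordinate of h as
  w.\<close>

lemma analytic_germ_stem_imnorm:
  shows "analytic_germ (\<lambda>h. fst (F ((p + h)$0, imnorm (p + h))) \<bullet> e)" (is ?thesis1)
    and "i \<noteq> 0 \<Longrightarrow> analytic_germ (\<lambda>h. (p + h)$i / imnorm (p + h) * (snd (F ((p + h)$0, imnorm (p + h))) \<bullet> e))"
      (is "_ \<Longrightarrow> ?thesis2")
proof -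
  let ?r = "imnorm p"
  have "?thesis1 \<and> (i \<noteq> 0 \<longrightarrow> ?thesis2)"
  proof (cases "?r = 0")
    case False
    then have q0: "q 0 > 0" using q(2)[of 0] q(3)[of 0] by (metis add_0_right less_eq_real_def real_sqrt_zero)
    have root: "analytic_germ (\<lambda>h. imnorm (p + h))"
      using analytic_germ_powr[OF q(1) q0 q(2), of "1/2"] q(2) by (simp add: powr_half_sqrt q(3))
    have inv: "analytic_germ (\<lambda>h. 1 / imnorm (p + h))"
      using analytic_germ_powr[OF q(1) q0 q(2), of "- (1/2)"] q(2)
      by (simp only: powr_minus powr_half_sqrt q(3) inverse_eq_divide)
    have diff: "analytic_germ (\<lambda>h. imnorm (p + h) - ?r)"
      by (intro analytic_germ_diff root analytic_germ_const)
    \<comment> \<open>The arguments are increments from the base point, since composition of germs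
      requires an inner map vanishing at 0.\<close>
    have comp: "analytic_germ (\<lambda>h. g (h$0, imnorm (p + h) - ?r))" if "analytic_germ g" for g
      by (rule analytic_germ_pair[OF that analytic_germ_nth diff]) simp_all
    have ?thesis1 using comp[OF stem_germs(1)] by simp
    moreover have ?thesis2
      using analytic_germ_mult[OF analytic_germ_mult[OF analytic_germ_nth_add[of p i] inv] comp[OF stem_germs(2)]]
      by simp
    ultimately show ?thesis by blast
  next
    case True
    then have pz: "p$1 = 0" "p$2 = 0" "p$3 = 0" by (auto simp: imnorm_eq_0)
    have q0: "q 0 = 0" by (simp add: q_def pz)
    have "(p$0, 0) \<in> D" using p True by (simp add: Edom_iff)
    \<comment> \<open>As D is open, the parity identities hold in a whole neighbourhood of the base
      point.\<close>
    from eventually_add_mem_open[OF D this]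
    have ev: "eventually (\<lambda>k. (p$0 + fst k, snd k) \<in> D) (nhds 0)"
      by eventually_elim (simp add: plus_prod_def)
    have Fs: "fst (F (a, -b)) = fst (F (a, b)) \<and> snd (F (a, -b)) = - snd (F (a, b))" if "(a, b) \<in> D" for a b
      using F that by (auto simp: stems_def)
    have "analytic_germ (\<lambda>h. fst (F ((p$0, ?r) + (h$0, sqrt (q h)))) \<bullet> e)"
    proof (rule analytic_germ_even_sqrt[OF stem_germs(1) _ analytic_germ_nth _ q(1) q0 q(2)])
      show "eventually (\<lambda>k. fst (F ((p$0, ?r) + (fst k, - snd k))) \<bullet> e = fst (F ((p$0, ?r) + k)) \<bullet> e) (nhds 0)"
        using ev by eventually_elim (simp add: True Fs plus_prod_def)
    qed simp
    then have ?thesis1 by (simp add: True q(3))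
    moreover have ?thesis2 if i: "i \<noteq> 0"
    proof -
      have "analytic_germ (\<lambda>h. (p + h)$i / sqrt (q h) * (snd (F ((p$0, ?r) + (h$0, sqrt (q h)))) \<bullet> e))"
      proof (rule analytic_germ_odd_sqrt[OF stem_germs(2) _ analytic_germ_nth _ q(1) q0 q(2) analytic_germ_nth_add])
        show "eventually (\<lambda>k. snd (F ((p$0, ?r) + (fst k, - snd k))) \<bullet> e = - (snd (F ((p$0, ?r) + k)) \<bullet> e)) (nhds 0)"
          using ev by eventually_elim (simp add: True Fs plus_prod_def)
        fix h assume "q h = 0"
        then have "imnorm (p + h) = 0" using q(3)[of h] by simp
        then show "(p + h) $ i = 0"
          using i forall_4_from_0[of "\<lambda>i. i \<noteq> 0 \<longrightarrow> (p + h) $ i = 0"] unfolding imnorm_eq_0 by simp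
      qed simp
      then show ?thesis by (simp add: True q(3))
    qed
    ultimately show ?thesis by blast
  qed
  then show ?thesis1 and "i \<noteq> 0 \<Longrightarrow> ?thesis2" by blast+
qed

end

text \<open>One direction applies the explicit formula near each point of \<open>Edom D\<close>. The
  other composes G with the affine embedding \<open>emb2\<close> of the plane.\<close>

lemma real_analytic_O3stem_iff:
  assumes sym: "\<forall>(a, b) \<in> D. (a, - b) \<in> D" and D: "open D" and G: "G \<in> O3stems (Edom D)"
  shows "real_analytic_on (Phi D G) D \<longleftrightarrow> real_analytic_on G (Edom D)"
proof
  assume an: "real_analytic_on (Phi D G) D"
  show "real_analytic_on G (Edom D)"
    unfolding real_analytic_on_iff_germ
  proof (intro ballI)
    fix b :: "oct^4" and p assume "b \<in> Basis" and p: "p \<in> Edom D"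
    then obtain i e where b: "b = axis i e" and e: "e \<in> Basis" by (auto simp: Basis_vec_def)
    note germs = analytic_germ_stem_imnorm[OF p Phi_in_stems[OF sym G] an e D]
    have ev: "eventually (\<lambda>h. p + h \<in> Edom D) (nhds 0)"
      by (rule eventually_add_mem_open[OF open_Edom[OF D] p])
    show "analytic_germ (\<lambda>h. G (p + h) \<bullet> b)"
    proof (cases "i = 0")
      case True
      show ?thesis
        by (rule analytic_germ_cong[OF germs(1)], use ev in eventually_elim)
          (simp add: b True inner_axis O3stem_formula(1)[OF sym G])
    next
      case False
      show ?thesis
        by (rule analytic_germ_cong[OF germs(2)[OF False]], use ev in eventually_elim)
          (simp add: b inner_axis O3stem_formula(2)[OF sym G _ False])
    qed
  qed
next
  assume an: "real_analytic_on G (Edom D)"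
  show "real_analytic_on (Phi D G) D"
    unfolding real_analytic_on_iff_germ
  proof (intro ballI)
    fix b :: "oct \<times> oct" and p assume b: "b \<in> Basis" and p: "p \<in> D"
    obtain x y where xy: "p = (x, y)" by (cases p)
    \<comment> \<open>A real coordinate of the pair is a real coordinate of component i of G, with i
      = 0 or i = 1.\<close>
    from b obtain i :: 4 and e where e: "e \<in> Basis" and bi: "\<And>w. (w $ 0, w $ 1) \<bullet> b = w \<bullet> axis i e"
      unfolding Basis_prod_def by (auto simp: inner_prod_def inner_axis)
    have "analytic_germ (\<lambda>h. G (emb2 x y + h) \<bullet> axis i e)"
      using an e emb2_in_Edom[OF sym] p unfolding real_analytic_on_iff_germ xy
      by (auto simp: axis_in_Basis_iff)
    moreover have "analytic_germ (\<lambda>h. emb2 (fst h) (snd h) $ j)" for j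
      using forall_4_from_0[of "\<lambda>j. analytic_germ (\<lambda>h. emb2 (fst h) (snd h) $ j)"]
        analytic_germ_coord[of "(1::real, 0::real)"] analytic_germ_coord[of "(0::real, 1::real)"]
      by (simp add: analytic_germ_const Basis_prod_def inner_prod_def)
    then have "analytic_germ (\<lambda>h. emb2 (fst h) (snd h) \<bullet> k)" if "k \<in> Basis" for k
      using that by (auto simp: Basis_vec_def inner_axis)
    moreover have "emb2 (fst 0) (snd 0) = 0" by (simp add: vec_eq_iff emb2_def)
    ultimately have "analytic_germ (\<lambda>h. G (emb2 x y + emb2 (fst h) (snd h)) \<bullet> axis i e)"
      by (rule analytic_germ_compose[of "\<lambda>h. G (emb2 x y + h) \<bullet> axis i e"])
    then show "analytic_germ (\<lambda>h. Phi D G (p + h) \<bullet> b)"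
    proof (rule analytic_germ_cong)
      have add: "emb2 x y + emb2 s t = emb2 (x + s) (y + t)" for s t
        by (simp add: vec_eq_iff emb2_def)
      show "eventually (\<lambda>h. G (emb2 x y + emb2 (fst h) (snd h)) \<bullet> axis i e = Phi D G (p + h) \<bullet> b) (nhds 0)"
        using eventually_add_mem_open[OF D p]
        by eventually_elim (simp add: xy plus_prod_def Phi_apply[OF sym] bi add)
    qed
  qed
qed

section \<open>Assembly of the statements\<close>

theorem theorem2p1:
  fixes D :: "(real \<times> real) set"
  assumes "open D" and "D \<noteq> {}"
    and "\<forall>(a, b) \<in> D. (a, - b) \<in> D"
    and "connected (OmegaD D)"
  shows "(\<forall>f :: oct \<Rightarrow> oct. is_O3_slice D f \<longleftrightarrow> is_slice D f)
    \<and> bij_betw (Phi D) (O3stems (Edom D)) (stems D)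
    \<and> (\<forall>G \<in> O3stems (Edom D). \<forall>f :: oct \<Rightarrow> oct.
          O3_induced (Edom D) G f \<longleftrightarrow> slice_induced D (Phi D G) f)
    \<and> (\<forall>F \<in> stems D. \<forall>G \<in> O3stems (Edom D). Phi D G = F \<longrightarrow>
          (\<forall>v \<in> Edom D. sqrt ((v$1)\<^sup>2 + (v$2)\<^sup>2 + (v$3)\<^sup>2) > 0 \<longrightarrow>
             (let r = sqrt ((v$1)\<^sup>2 + (v$2)\<^sup>2 + (v$3)\<^sup>2) in
               G v $ 0 = fst (F (v$0, r))
               \<and> (\<forall>h \<in> {1, 2, 3}. G v $ h = (v$h / r) *\<^sub>R snd (F (v$0, r)))))
          \<and> (real_analytic_on F D \<longleftrightarrow> real_analytic_on G (Edom D)))"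
proof (intro conjI)
  note sym = assms(3)
  show bij: "bij_betw (Phi D) (O3stems (Edom D)) (stems D)" by (rule Phi_bij[OF sym])
  show ind: "\<forall>G \<in> O3stems (Edom D). \<forall>f :: oct \<Rightarrow> oct.
          O3_induced (Edom D) G f \<longleftrightarrow> slice_induced D (Phi D G) f"
    using O3_induced_iff_slice_induced[OF sym] by blast
  show "\<forall>f :: oct \<Rightarrow> oct. is_O3_slice D f \<longleftrightarrow> is_slice D f"
    \<comment> \<open>Rewriting \<open>stems D\<close> as the image of \<open>Phi D\<close> makes
      both existential quantifiers range over \<open>O3stems (Edom D)\<close>.\<close>
    unfolding is_O3_slice_def is_slice_def bij_betw_imp_surj_on[OF bij, symmetric] bex_simps(7)
    using ind by (intro allI bex_cong) auto
  show "\<forall>F \<in> stems D. \<forall>G \<in> O3stems (Edom D). Phi D G = F \<longrightarrow>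
          (\<forall>v \<in> Edom D. sqrt ((v$1)\<^sup>2 + (v$2)\<^sup>2 + (v$3)\<^sup>2) > 0 \<longrightarrow>
             (let r = sqrt ((v$1)\<^sup>2 + (v$2)\<^sup>2 + (v$3)\<^sup>2) in
               G v $ 0 = fst (F (v$0, r))
               \<and> (\<forall>h \<in> {1, 2, 3}. G v $ h = (v$h / r) *\<^sub>R snd (F (v$0, r)))))
          \<and> (real_analytic_on F D \<longleftrightarrow> real_analytic_on G (Edom D))"
    unfolding imnorm_def[symmetric] Let_def
  proof (intro ballI impI conjI)
    fix F G v h
    assume G: "G \<in> O3stems (Edom D)" and F: "Phi D G = F"
    show "real_analytic_on F D \<longleftrightarrow> real_analytic_on G (Edom D)"
      using real_analytic_O3stem_iff[OF sym assms(1) G] F by simp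
    assume v: "v \<in> Edom D"
    show "G v $ 0 = fst (F (v$0, imnorm v))"
      using O3stem_formula(1)[OF sym G v] F by simp
    assume "h \<in> {1, 2, 3 :: 4}"
    then have "h \<noteq> 0" by auto
    then show "G v $ h = (v$h / imnorm v) *\<^sub>R snd (F (v$0, imnorm v))"
      using O3stem_formula(2)[OF sym G v] F by simp
  qed
qed

end
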